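(* For every $r\ge 2$, given an instance $(V,\mathcal{E},k)$ of Test-$r$-Cover$(n-k)$, it is possible to transform it in polynomial time into an equivalent instance of Test-$r$-Cover$(n-k)$ with at most $18k^3r$ vertices and at most $(18k^3r)^r$ edges.
   Context: An edge $e$ of a hypergraph $(V,\mathcal{E})$ separates vertices $x,y$ if $|\{x,y\}\cap e|=1$; $\mathcal{T}\subseteq\mathcal{E}$ is a test cover if every pair of distinct vertices is separated by an edge of $\mathcal{T}$. Test-$r$-Cover$(n-k)$: given a hypergraph $(V,\mathcal{E})$ with $|V|=n$, every edge of size at most $r$, $\mathcal{E}$ a test cover, and an integer parameter $k$, decide whether there is a test cover $\mathcal{T}\subseteq\mathcal{E}$ with at most $n-k$ edges, where $n$ is the number of vertices of the instance. Two instances are equivalent if both are yes-instances or both are no-instances. *)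

theory Defs
  imports Main "HOL-Computational_Algebra.Polynomial"
begin

section \<open>Test covers\<close>

definition separates :: "'a set \<Rightarrow> 'a \<Rightarrow> 'a \<Rightarrow> bool" where
  "separates e x y \<longleftrightarrow> card ({x, y} \<inter> e) = 1"

definition test_cover :: "'a set \<Rightarrow> 'a set set \<Rightarrow> bool" where
  "test_cover V T \<longleftrightarrow> (\<forall>x\<in>V. \<forall>y\<in>V. x \<noteq> y \<longrightarrow> (\<exists>e\<in>T. separates e x y))"

text \<open>
  An instance is a triple of vertex set, edge set and parameter. So that instances can be
  given to a program, vertices are natural numbers (not necessarily an initial segment).
\<close>

type_synonym test_inst = "nat set \<times> nat set set \<times> nat"

definition test_r_cover_instance :: "nat \<Rightarrow> test_inst \<Rightarrow> bool" where
  "test_r_cover_instance r = (\<lambda>(V, E, k).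
     finite V \<and> E \<subseteq> Pow V \<and> (\<forall>e\<in>E. card e \<le> r) \<and> test_cover V E)"

text \<open>The bound is an integer: there is no solution if the parameter exceeds the number of vertices.\<close>

definition yes_instance :: "test_inst \<Rightarrow> bool" where
  "yes_instance = (\<lambda>(V, E, k).
     \<exists>T\<subseteq>E. test_cover V T \<and> int (card T) \<le> int (card V) - int k)"

definition equivalent_instances :: "test_inst \<Rightarrow> test_inst \<Rightarrow> bool" where
  "equivalent_instances I J \<longleftrightarrow> (yes_instance I \<longleftrightarrow> yes_instance J)"


section \<open>Polynomial time\<close>

text \<open>
  The machine model is a WHILE language over binary trees (as in Jones, Computability and
  Complexity from a Programming Perspective) with a size-dependent cost: evaluating an
  expression costs the total size of the values of all its subexpressions. Trees therefore
  cannot be copied at unit cost, every value occurring in a run is no larger than the input plus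
  the running time, and the programs running in polynomial time compute the same functions
  as polynomial-time Turing machines.
\<close>

datatype tree = Leaf | Node tree tree

datatype expr =
    EVar nat | ELeaf | ENode expr expr | ELeft expr | ERight expr | EEq expr expr

type_synonym store = "nat \<Rightarrow> tree"

primrec left :: "tree \<Rightarrow> tree" where
  "left Leaf = Leaf"
| "left (Node a b) = a"

primrec right :: "tree \<Rightarrow> tree" where
  "right Leaf = Leaf"
| "right (Node a b) = b"

text \<open>\<^term>\<open>Leaf\<close> is the only tree counting as false.\<close>

definition tree_of_bool :: "bool \<Rightarrow> tree" where
  "tree_of_bool b = (if b then Node Leaf Leaf else Leaf)"

primrec eval_expr :: "expr \<Rightarrow> store \<Rightarrow> tree" where
  "eval_expr (EVar v) s = s v"
| "eval_expr ELeaf s = Leaf"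
| "eval_expr (ENode a b) s = Node (eval_expr a s) (eval_expr b s)"
| "eval_expr (ELeft a) s = left (eval_expr a s)"
| "eval_expr (ERight a) s = right (eval_expr a s)"
| "eval_expr (EEq a b) s = tree_of_bool (eval_expr a s = eval_expr b s)"

text \<open>The predefined \<^const>\<open>size\<close> of a tree is its number of inner nodes, hence the successor.\<close>

primrec cost_expr :: "expr \<Rightarrow> store \<Rightarrow> nat" where
  "cost_expr (EVar v) s = Suc (size (s v))"
| "cost_expr ELeaf s = 1"
| "cost_expr (ENode a b) s =
     cost_expr a s + cost_expr b s + Suc (size (eval_expr (ENode a b) s))"
| "cost_expr (ELeft a) s = cost_expr a s + Suc (size (eval_expr (ELeft a) s))"
| "cost_expr (ERight a) s = cost_expr a s + Suc (size (eval_expr (ERight a) s))"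
| "cost_expr (EEq a b) s =
     cost_expr a s + cost_expr b s + Suc (size (eval_expr (EEq a b) s))"

datatype com = Skip | Assign nat expr | Seq com com | If expr com com | While expr com

text \<open>\<open>exec c s t s'\<close>: started in store \<open>s\<close>, command \<open>c\<close> halts in store \<open>s'\<close> after time \<open>t\<close>.\<close>

inductive exec :: "com \<Rightarrow> store \<Rightarrow> nat \<Rightarrow> store \<Rightarrow> bool" where
  Skip: "exec Skip s 1 s"
| Assign: "exec (Assign v e) s (Suc (cost_expr e s)) (s(v := eval_expr e s))"
| Seq: "\<lbrakk> exec c1 s t1 s'; exec c2 s' t2 s'' \<rbrakk> \<Longrightarrow> exec (Seq c1 c2) s (Suc (t1 + t2)) s''"
| IfTrue: "\<lbrakk> eval_expr e s \<noteq> Leaf; exec c1 s t s' \<rbrakk>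
    \<Longrightarrow> exec (If e c1 c2) s (Suc (cost_expr e s + t)) s'"
| IfFalse: "\<lbrakk> eval_expr e s = Leaf; exec c2 s t s' \<rbrakk>
    \<Longrightarrow> exec (If e c1 c2) s (Suc (cost_expr e s + t)) s'"
| WhileFalse: "eval_expr e s = Leaf \<Longrightarrow> exec (While e c) s (Suc (cost_expr e s)) s"
| WhileTrue: "\<lbrakk> eval_expr e s \<noteq> Leaf; exec c s t1 s'; exec (While e c) s' t2 s'' \<rbrakk>
    \<Longrightarrow> exec (While e c) s (Suc (cost_expr e s + t1 + t2)) s''"

text \<open>Input and output are passed in variable 0; all other variables initially hold \<^term>\<open>Leaf\<close>.\<close>

definition computes_in :: "com \<Rightarrow> tree \<Rightarrow> nat \<Rightarrow> tree \<Rightarrow> bool" where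
  "computes_in c x t y \<longleftrightarrow> (\<exists>s. exec c ((\<lambda>_. Leaf)(0 := x)) t s \<and> s 0 = y)"

definition poly_time_on :: "tree set \<Rightarrow> (tree \<Rightarrow> tree) \<Rightarrow> bool" where
  "poly_time_on A f \<longleftrightarrow>
     (\<exists>(c :: com) (p :: nat poly). \<forall>x\<in>A. \<exists>t \<le> poly p (size x). computes_in c x t (f x))"


section \<open>Encoding of instances\<close>

text \<open>Numbers are written in binary, least significant bit first, without leading zeros.\<close>

fun enc_nat :: "nat \<Rightarrow> tree" where
  "enc_nat n = (if n = 0 then Leaf else Node (tree_of_bool (odd n)) (enc_nat (n div 2)))"

declare enc_nat.simps [simp del]

primrec enc_list :: "('a \<Rightarrow> tree) \<Rightarrow> 'a list \<Rightarrow> tree" where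
  "enc_list f [] = Leaf"
| "enc_list f (x # xs) = Node (f x) (enc_list f xs)"

text \<open>
  The vertices, the edges and the vertices of each edge are listed without repetition, but in an
  arbitrary order, so an instance has several encodings.
\<close>

definition encodes :: "tree \<Rightarrow> test_inst \<Rightarrow> bool" where
  "encodes x = (\<lambda>(V, E, k). \<exists>vs es.
     distinct vs \<and> set vs = V \<and>
     (\<forall>e\<in>set es. distinct e) \<and> distinct (map set es) \<and> set (map set es) = E \<and>
     x = Node (enc_list enc_nat vs) (Node (enc_list (enc_list enc_nat) es) (enc_nat k)))"

end

theory Submission
  imports Defs
begin

text \<open>
  Write F for a set of edges, call two vertices equivalent if no edge of F separates them, and
  let the excess of F be the number of classes minus |F|. Since every edge that separates two
  equivalent vertices adds a class, there is a test cover with at most n-k edges iff some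
  F \<subseteq> E has excess at least k. If enlarging an edge set raises the excess, then already
  one of the new edges that cuts two classes, or two of them that cross inside one class, do so.

  Greedily collect T by adding pairs of edges that create at least three new classes. If the
  excess reaches k, the answer is yes. Otherwise |T| \<le> 2k-4 and there are at most 3k-5 classes.
  Let X be the set of vertices covered by T and C the rest. If |C| \<le> 2r, the instance is
  already small. Otherwise an edge meeting C is a union of classes inside X, and the traces of the
  edges on C form a laminar family, so that C falls into components of at most r vertices. A
  component matters only through the pairs of classes, C counting as one of them, that its edges
  separate. For every pair keep 4k components whose edges separate it, and one further vertex that
  represents the rest. In a solution, built up in steps from at most 2k-2 edges, an edge in a dropped
  component is replaced by edges separating the same pair in kept components that are still unused.

  For the running time, polynomial-time computable functions between types with an encoding as trees
  are closed under composition, pairing, case distinction and folds over lists with states of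
  polynomial size.
\<close>

section \<open>Classes induced by a set of edges\<close>

text \<open>The excess is defined for every edge set, so partial solutions can be compared and
  grown. The empty set has excess 1, and a useful step spends at most two edges for a gain of at
  least 1; hence |F| \<le> 2 (excess - 1) all along. So a solution S can be cut down to 2k-2 edges,
  and an F still short of k has at most 2k-4. The obstacle is that S must remain a promise while F
  grows inside the kernel: replacing a step of S may not lower the excess of F \<union> S. A new
  edge is therefore taken from a component that no edge of F \<union> S meets, where it separates a
  vertex covered by none of them from another such vertex and so pays for itself. Each edge meets at
  most one component, F \<union> S has at most 4k-6 edges, and three untouched components suffice,
  two for new edges and one for a vertex outside both; this explains 4k. With at most 3k classes
  there are at most 3k(3k-1)/2 pairs, and 4k components of at most r vertices for each of them give
  18k^3 r - 6k^2 r vertices. The remainder pays for X and the representative.\<close>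

definition sig :: "'a set set \<Rightarrow> 'a \<Rightarrow> 'a set set" where
  "sig F v = {e \<in> F. v \<in> e}"

definition classes :: "'a set \<Rightarrow> 'a set set \<Rightarrow> nat" where
  "classes V F = card (sig F ` V)"

definition excess :: "'a set \<Rightarrow> 'a set set \<Rightarrow> int" where
  "excess V F = int (classes V F) - int (card F)"

lemma separates_iff: "x \<noteq> y \<Longrightarrow> separates e x y \<longleftrightarrow> (x \<in> e) \<noteq> (y \<in> e)"
  by (cases "x \<in> e"; cases "y \<in> e") (auto simp: separates_def)

lemma sig_mono_eq: "sig G x = sig G y \<Longrightarrow> F \<subseteq> G \<Longrightarrow> sig F x = sig F y"
  unfolding sig_def by blast

lemma sig_empty_mono: "sig G x = {} \<Longrightarrow> F \<subseteq> G \<Longrightarrow> sig F x = {}"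
  unfolding sig_def by blast

lemma sig_eqD: "sig F x = sig F y \<Longrightarrow> e \<in> F \<Longrightarrow> x \<in> e \<longleftrightarrow> y \<in> e"
  unfolding sig_def by blast

lemma sig_insert: "sig (insert e F) v = (if v \<in> e then insert e (sig F v) else sig F v)"
  by (auto simp: sig_def)

lemma test_cover_iff: "test_cover V F \<longleftrightarrow> inj_on (sig F) V"
proof
  assume t: "test_cover V F"
  show "inj_on (sig F) V"
  proof (rule inj_onI, rule ccontr)
    fix x y assume xy: "x \<in> V" "y \<in> V" "sig F x = sig F y" "x \<noteq> y"
    then obtain e where "e \<in> F" "separates e x y" using t unfolding test_cover_def by blast
    then show False using xy sig_eqD separates_iff by metis
  qed
next
  assume i: "inj_on (sig F) V"
  show "test_cover V F"
    unfolding test_cover_def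
  proof (intro ballI impI)
    fix x y assume xy: "x \<in> V" "y \<in> V" "x \<noteq> y"
    then have "sig F x \<noteq> sig F y" using i by (meson inj_onD)
    then obtain e where "e \<in> F" "(x \<in> e) \<noteq> (y \<in> e)" unfolding sig_def by blast
    then show "\<exists>e\<in>F. separates e x y" using separates_iff xy(3) by metis
  qed
qed

lemma classes_le_card: "finite V \<Longrightarrow> classes V F \<le> card V"
  unfolding classes_def by (rule card_image_le)

text \<open>The signatures of the vertices in \<open>e\<close> receive the new element
  \<open>e\<close>, which makes the two images disjoint. Their overlap before the insertion, that
  is, the set of classes cut by \<open>e\<close>, is what the count gains.\<close>

lemma classes_insert:
  assumes "finite V"
  shows "classes V (insert e F) = classes V F + card (sig F ` (V \<inter> e) \<inter> sig F ` (V - e))"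
proof (cases "e \<in> F")
  case True
  then have "sig F ` (V \<inter> e) \<inter> sig F ` (V - e) = {}"
    by (auto simp: sig_def)
  moreover have "insert e F = F" using True by blast
  ultimately show ?thesis by simp
next
  case False
  let ?A = "sig F ` (V \<inter> e)" and ?B = "sig F ` (V - e)"
  have "sig (insert e F) ` V = insert e ` ?A \<union> ?B"
    by (auto simp: sig_insert image_iff)
  moreover have "insert e ` ?A \<inter> ?B = {}"
    using False by (auto simp: sig_def)
  moreover have "inj_on (insert e) ?A"
    using False by (auto simp: inj_on_def sig_def)
  moreover have "?A \<union> ?B = sig F ` V" by blast
  ultimately show ?thesis
    using assms card_Un_Int[of ?A ?B] unfolding classes_def
    by (simp add: card_Un_disjoint card_image)
qed

lemma classes_insert_ge1:
  assumes "finite V" "x \<in> V" "y \<in> V" "sig F x = sig F y" "x \<in> e" "y \<notin> e"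
  shows "classes V F + 1 \<le> classes V (insert e F)"
proof -
  have "sig F x \<in> sig F ` (V \<inter> e) \<inter> sig F ` (V - e)" using assms by auto
  then have "0 < card (sig F ` (V \<inter> e) \<inter> sig F ` (V - e))"
    using assms(1) card_gt_0_iff by blast
  then show ?thesis using classes_insert[OF assms(1), of e F] by simp
qed

text \<open>For the converse, an F of sufficient excess with the most classes is already a test
  cover: a separating edge from E would cost one edge, gain a class and contradict the
  choice.\<close>

lemma yes_instance_iff_excess:
  assumes "finite V" "E \<subseteq> Pow V" "test_cover V E"
  shows "yes_instance (V, E, k) \<longleftrightarrow> (\<exists>F\<subseteq>E. int k \<le> excess V F)"
proof
  assume "yes_instance (V, E, k)"
  then obtain T where T: "T \<subseteq> E" "test_cover V T" "int (card T) \<le> int (card V) - int k"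
    unfolding yes_instance_def by auto
  have "classes V T = card V"
    using T(2) unfolding test_cover_iff classes_def by (rule card_image)
  then show "\<exists>F\<subseteq>E. int k \<le> excess V F"
    using T unfolding excess_def by (intro exI[of _ T]) auto
next
  assume "\<exists>F\<subseteq>E. int k \<le> excess V F"
  then have "\<exists>F. F \<subseteq> E \<and> int k \<le> excess V F" by blast
  moreover have "\<forall>F. F \<subseteq> E \<and> int k \<le> excess V F \<longrightarrow> classes V F < Suc (card V)"
    using classes_le_card[OF assms(1)] by (auto simp: le_imp_less_Suc)
  ultimately obtain F where F: "F \<subseteq> E" "int k \<le> excess V F"
    and max: "\<And>G. G \<subseteq> E \<Longrightarrow> int k \<le> excess V G \<Longrightarrow> classes V G \<le> classes V F"
    using ex_has_greatest_nat[of "\<lambda>F. F \<subseteq> E \<and> int k \<le> excess V F" _ "classes V" "Suc (card V)"]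
    by (metis less_imp_le_nat)
  have fin: "finite F" using F(1) assms(1,2) by (meson finite_Pow_iff finite_subset)
  have inj: "inj_on (sig F) V"
  proof (rule inj_onI, rule ccontr)
    fix x y assume xy: "x \<in> V" "y \<in> V" "sig F x = sig F y" "x \<noteq> y"
    then obtain e where e: "e \<in> E" "separates e x y"
      using assms(3) unfolding test_cover_def by blast
    then have "(x \<in> e) \<noteq> (y \<in> e)" using separates_iff xy(4) by metis
    then have c: "classes V F + 1 \<le> classes V (insert e F)"
      using classes_insert_ge1[OF assms(1)] xy by metis
    have "card (insert e F) \<le> card F + 1" by (simp add: card_insert_if fin)
    then have "int k \<le> excess V (insert e F)" using F(2) c unfolding excess_def by linarith
    then have "classes V (insert e F) \<le> classes V F" using max e(1) F(1) by blast
    then show False using c by simp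
  qed
  then have "test_cover V F" "classes V F = card V"
    by (simp_all add: test_cover_iff classes_def card_image)
  then show "yes_instance (V, E, k)"
    using F unfolding yes_instance_def excess_def by auto
qed

section \<open>Edges that raise the excess\<close>

text \<open>The least an edge must do to raise the excess by itself, since a single cut class only
  pays for the edge.\<close>

definition cuts_two :: "'a set \<Rightarrow> 'a set set \<Rightarrow> 'a set \<Rightarrow> bool" where
  "cuts_two V F e \<longleftrightarrow> (\<exists>x\<in>V. \<exists>y\<in>V. \<exists>x'\<in>V. \<exists>y'\<in>V.
     sig F x = sig F y \<and> sig F x' = sig F y' \<and> sig F x \<noteq> sig F x' \<and>
     x \<in> e \<and> y \<notin> e \<and> x' \<in> e \<and> y' \<notin> e)"

text \<open>All four cells of \<open>e\<close> and \<open>f\<close> are inhabited within one class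
  of F, so two edges yield three new classes.\<close>

definition cross :: "'a set \<Rightarrow> 'a set set \<Rightarrow> 'a set \<Rightarrow> 'a set \<Rightarrow> bool" where
  "cross V F e f \<longleftrightarrow> (\<exists>a\<in>V. \<exists>b\<in>V. \<exists>c\<in>V. \<exists>d\<in>V.
     sig F a = sig F b \<and> sig F a = sig F c \<and> sig F a = sig F d \<and>
     a \<in> e \<and> a \<in> f \<and> b \<in> e \<and> b \<notin> f \<and> c \<notin> e \<and> c \<in> f \<and> d \<notin> e \<and> d \<notin> f)"

lemma cuts_twoI:
  assumes "x \<in> V" "y \<in> V" "x' \<in> V" "y' \<in> V"
    "sig F x = sig F y" "sig F x' = sig F y'" "sig F x \<noteq> sig F x'"
    "x \<in> e" "y \<notin> e" "x' \<in> e" "y' \<notin> e"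
  shows "cuts_two V F e"
  using assms unfolding cuts_two_def by metis

lemma crossI:
  assumes "a \<in> V" "b \<in> V" "c \<in> V" "d \<in> V"
    "sig F a = sig F b" "sig F a = sig F c" "sig F a = sig F d"
    "a \<in> e" "a \<in> f" "b \<in> e" "b \<notin> f" "c \<notin> e" "c \<in> f" "d \<notin> e" "d \<notin> f"
  shows "cross V F e f"
  using assms unfolding cross_def by metis

lemma crossE:
  assumes "cross V F e f"
  obtains a b c d where "a \<in> V" "b \<in> V" "c \<in> V" "d \<in> V"
    "sig F a = sig F b" "sig F a = sig F c" "sig F a = sig F d"
    "a \<in> e" "a \<in> f" "b \<in> e" "b \<notin> f" "c \<notin> e" "c \<in> f" "d \<notin> e" "d \<notin> f"
  using assms unfolding cross_def by (elim bexE conjE) (rule that)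

lemma cross_sym: "cross V F e f \<Longrightarrow> cross V F f e"
  unfolding cross_def by metis

lemma cross_neq: "cross V F e f \<Longrightarrow> e \<noteq> f"
  unfolding cross_def by metis

lemma classes_cuts_two:
  assumes "finite V" "cuts_two V F e"
  shows "classes V F + 2 \<le> classes V (insert e F)"
proof -
  obtain x y x' y' where *: "x \<in> V" "y \<in> V" "x' \<in> V" "y' \<in> V"
    "sig F x = sig F y" "sig F x' = sig F y'" "sig F x \<noteq> sig F x'"
    "x \<in> e" "y \<notin> e" "x' \<in> e" "y' \<notin> e"
    using assms(2) unfolding cuts_two_def by blast
  have "{sig F x, sig F x'} \<subseteq> sig F ` (V \<inter> e) \<inter> sig F ` (V - e)" using * by auto
  then have "card {sig F x, sig F x'} \<le> card (sig F ` (V \<inter> e) \<inter> sig F ` (V - e))"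
    using assms(1) by (intro card_mono) auto
  then show ?thesis using classes_insert[OF assms(1), of e F] *(7) by simp
qed

lemma classes_not_cuts_two:
  assumes "finite V" "\<not> cuts_two V F e"
  shows "classes V (insert e F) \<le> classes V F + 1"
proof -
  let ?I = "sig F ` (V \<inter> e) \<inter> sig F ` (V - e)"
  have "s = s'" if "s \<in> ?I" "s' \<in> ?I" for s s'
  proof (rule ccontr)
    assume "s \<noteq> s'"
    moreover obtain x x' where "x \<in> V" "x \<in> e" "s = sig F x" "x' \<in> V" "x' \<in> e" "s' = sig F x'"
      using \<open>s \<in> ?I\<close> \<open>s' \<in> ?I\<close> by blast
    moreover obtain y y' where "y \<in> V" "y \<notin> e" "s = sig F y" "y' \<in> V" "y' \<notin> e" "s' = sig F y'"
      using \<open>s \<in> ?I\<close> \<open>s' \<in> ?I\<close> by blast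
    ultimately have "cuts_two V F e" by (intro cuts_twoI[of x _ y x' y']) auto
    then show False using assms(2) by blast
  qed
  then have "card ?I \<le> Suc 0" using assms(1) card_le_Suc0_iff_eq[of ?I] by blast
  then show ?thesis using classes_insert[OF assms(1), of e F] by simp
qed

text \<open>Adding \<open>f\<close> halves the common class, and \<open>e\<close> cuts both
  halves.\<close>

lemma classes_cross:
  assumes "finite V" "cross V F e f"
  shows "classes V F + 3 \<le> classes V (insert e (insert f F))"
proof -
  obtain a b c d where *: "a \<in> V" "b \<in> V" "c \<in> V" "d \<in> V"
    "sig F a = sig F b" "sig F a = sig F c" "sig F a = sig F d"
    "a \<in> e" "a \<in> f" "b \<in> e" "b \<notin> f" "c \<notin> e" "c \<in> f" "d \<notin> e" "d \<notin> f"
    using assms(2) by (rule crossE)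
  have 1: "classes V F + 1 \<le> classes V (insert f F)"
    by (rule classes_insert_ge1[OF assms(1), of a b]) (use * in auto)
  show ?thesis
  proof (cases "f \<in> F")
    case True
    then show ?thesis using sig_eqD[OF *(5) True] *(9,11) by blast
  next
    case False
    then have "f \<notin> sig F d" by (auto simp: sig_def)
    then have "sig (insert f F) a \<noteq> sig (insert f F) b"
      using * by (auto simp: sig_insert)
    then have "cuts_two V (insert f F) e"
      by (intro cuts_twoI[of a _ c b d]) (use * in \<open>auto simp: sig_insert\<close>)
    from classes_cuts_two[OF assms(1) this] 1 show ?thesis by simp
  qed
qed

text \<open>Both hypotheses survive the insertion of \<open>e\<close> into F. If \<open>f\<close>
  cuts two classes of \<open>insert e F\<close>, these come either from two classes of F or from the
  two halves of one class, and in the latter case \<open>e\<close> and \<open>f\<close> cross. So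
  the edges of W can be added one at a time, each gaining at most one class.\<close>

lemma classes_Un_le:
  assumes "finite V" "finite W"
    and "\<And>e. e \<in> W \<Longrightarrow> \<not> cuts_two V F e"
    and "\<And>e f. e \<in> W \<Longrightarrow> f \<in> W \<Longrightarrow> \<not> cross V F e f"
  shows "classes V (F \<union> W) \<le> classes V F + card W"
  using assms(2-)
proof (induction W arbitrary: F rule: finite_induct)
  case (insert e W)
  have noS: "\<not> cuts_two V (insert e F) f" if "f \<in> W" for f
  proof
    assume "cuts_two V (insert e F) f"
    then obtain x y x' y' where *: "x \<in> V" "y \<in> V" "x' \<in> V" "y' \<in> V"
      "sig (insert e F) x = sig (insert e F) y" "sig (insert e F) x' = sig (insert e F) y'"
      "sig (insert e F) x \<noteq> sig (insert e F) x'" "x \<in> f" "y \<notin> f" "x' \<in> f" "y' \<notin> f"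
      unfolding cuts_two_def by blast
    have s: "sig F x = sig F y" "sig F x' = sig F y'" "x \<in> e \<longleftrightarrow> y \<in> e" "x' \<in> e \<longleftrightarrow> y' \<in> e"
      using sig_mono_eq[OF *(5) subset_insertI] sig_mono_eq[OF *(6) subset_insertI]
        sig_eqD[OF *(5) insertI1] sig_eqD[OF *(6) insertI1] by blast+
    show False
    proof (cases "sig F x = sig F x'")
      case False
      then have "cuts_two V F f"
        using *(1-4,8-) s by (intro cuts_twoI[of x _ y x' y']) auto
      then show ?thesis using insert.prems(1) that by blast
    next
      case True
      then have "(x \<in> e) \<noteq> (x' \<in> e)" using *(7) by (auto simp: sig_insert split: if_splits)
      then have "cross V F e f"
      proof (cases "x \<in> e")
        case True
        then show ?thesis using *(1-4,8-) s \<open>sig F x = sig F x'\<close> \<open>(x \<in> e) \<noteq> (x' \<in> e)\<close>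
          by (intro crossI[of x _ y x' y']) auto
      next
        case False
        then show ?thesis using *(1-4,8-) s \<open>sig F x = sig F x'\<close> \<open>(x \<in> e) \<noteq> (x' \<in> e)\<close>
          by (intro crossI[of x' _ y' x y]) auto
      qed
      then show ?thesis using insert.prems(2) that by blast
    qed
  qed
  have noC: "\<not> cross V (insert e F) f g" if "f \<in> W" "g \<in> W" for f g
  proof
    assume "cross V (insert e F) f g"
    then have "cross V F f g"
    proof (rule crossE)
      fix a b c d
      assume *: "a \<in> V" "b \<in> V" "c \<in> V" "d \<in> V"
        "sig (insert e F) a = sig (insert e F) b" "sig (insert e F) a = sig (insert e F) c"
        "sig (insert e F) a = sig (insert e F) d"
        "a \<in> f" "a \<in> g" "b \<in> f" "b \<notin> g" "c \<notin> f" "c \<in> g" "d \<notin> f" "d \<notin> g"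
      show "cross V F f g"
        using *(1-4) *(5-7)[THEN sig_mono_eq[OF _ subset_insertI]] *(8-) by (rule crossI)
    qed
    then show False using insert.prems(2) that by blast
  qed
  have "classes V (insert e F \<union> W) \<le> classes V (insert e F) + card W"
    by (rule insert.IH) (use noS noC in auto)
  moreover have "classes V (insert e F) \<le> classes V F + 1"
    using classes_not_cuts_two[OF assms(1)] insert.prems(1) by blast
  ultimately show ?case using insert.hyps by simp
qed simp

text \<open>The limit of two edges for a gain of at least 1 is what preserves
  \<open>thrifty\<close>.\<close>

definition raises :: "'a set \<Rightarrow> 'a set set \<Rightarrow> 'a set set \<Rightarrow> bool" where
  "raises V F G \<longleftrightarrow> finite G \<and> card G \<le> 2 \<and> classes V F + card G + 1 \<le> classes V (F \<union> G)"

lemma raises_single: "finite V \<Longrightarrow> cuts_two V F e \<Longrightarrow> raises V F {e}"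
  using classes_cuts_two[of V F e] unfolding raises_def by simp

lemma raises_pair: "finite V \<Longrightarrow> cross V F e f \<Longrightarrow> raises V F {e, f}"
  using classes_cross[of V F e f] cross_neq[of V F e f] unfolding raises_def
  by (simp add: Un_commute)

text \<open>Contrapositive of \<open>classes_Un_le\<close>, applied to \<open>W - F\<close> so that
  the cardinalities add up.\<close>

lemma excess_gap_imp:
  assumes "finite V" "finite F" "finite W" "excess V F < excess V (F \<union> W)"
  obtains e where "e \<in> W" "cuts_two V F e" | e f where "e \<in> W" "f \<in> W" "cross V F e f"
proof -
  have "\<not> ((\<forall>e\<in>W - F. \<not> cuts_two V F e) \<and> (\<forall>e\<in>W - F. \<forall>f\<in>W - F. \<not> cross V F e f))"
  proof
    assume *: "(\<forall>e\<in>W - F. \<not> cuts_two V F e) \<and> (\<forall>e\<in>W - F. \<forall>f\<in>W - F. \<not> cross V F e f)"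
    have "classes V (F \<union> (W - F)) \<le> classes V F + card (W - F)"
      by (rule classes_Un_le) (use assms * in auto)
    moreover have "card (F \<union> (W - F)) = card F + card (W - F)"
      using assms by (intro card_Un_disjoint) auto
    ultimately show False using assms(4) unfolding excess_def by simp
  qed
  then show thesis using that by blast
qed

text \<open>Invariant of growth by \<open>raises\<close> steps; the subtracted 1 is the excess of
  the empty set on a nonempty V.\<close>

definition thrifty :: "'a set \<Rightarrow> 'a set set \<Rightarrow> bool" where
  "thrifty V F \<longleftrightarrow> finite F \<and> int (card F) \<le> 2 * (excess V F - 1)"

lemma thrifty_Un:
  assumes "thrifty V F" "raises V F G"
  shows "thrifty V (F \<union> G)" "excess V F + 1 \<le> excess V (F \<union> G)"
proof -
  have "card (F \<union> G) \<le> card F + card G" by (rule card_Un_le)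
  then show "thrifty V (F \<union> G)" "excess V F + 1 \<le> excess V (F \<union> G)"
    using assms unfolding thrifty_def raises_def excess_def by auto
qed

lemma thrifty_empty: "V \<noteq> {} \<Longrightarrow> thrifty V {}"
  and excess_empty: "V \<noteq> {} \<Longrightarrow> excess V {} = 1"
  by (auto simp: thrifty_def excess_def classes_def sig_def image_constant_conv)

lemma excess_le_card: "finite V \<Longrightarrow> excess V F \<le> int (card V)"
  using classes_le_card[of V F] unfolding excess_def by linarith

lemma exists_max_int:
  fixes f :: "'b \<Rightarrow> int"
  assumes "P x" "\<And>x. P x \<Longrightarrow> f x \<le> b"
  obtains y where "P y" "\<And>z. P z \<Longrightarrow> f z \<le> f y"
proof -
  define y where "y = arg_min (\<lambda>x. nat (b - f x)) P"
  have y: "P y" "\<And>z. P z \<Longrightarrow> nat (b - f y) \<le> nat (b - f z)"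
    using arg_min_nat_lemma[of P x "\<lambda>x. nat (b - f x)"] assms(1) unfolding y_def by auto
  have "f z \<le> f y" if "P z" for z
    using y(2)[OF that] assms(2)[OF that] assms(2)[OF y(1)] by linarith
  then show thesis using that y(1) by blast
qed

text \<open>A maximal thrifty subset of excess at most k either hits k or is one step short of
  passing it. In the second case its excess is at most k-1, so it has at most 2(k-2) edges, and the
  two edges of the last step still fit.\<close>

lemma small_subset_with_excess:
  assumes "finite V" "V \<noteq> {}" "finite T" "1 \<le> k" "int k \<le> excess V T"
  obtains F where "F \<subseteq> T" "int k \<le> excess V F" "card F \<le> 2 * (k - 1)"
proof -
  let ?P = "\<lambda>F. F \<subseteq> T \<and> thrifty V F \<and> excess V F \<le> int k"
  have "?P {}" using assms(4) by (simp add: thrifty_empty[OF assms(2)] excess_empty[OF assms(2)])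
  then obtain F where F: "?P F" and max: "\<And>G. ?P G \<Longrightarrow> excess V G \<le> excess V F"
    by (rule exists_max_int[where P = ?P and f = "excess V" and b = "int k"]) auto
  have fin: "finite F" using F unfolding thrifty_def by blast
  have "\<exists>F\<subseteq>T. int k \<le> excess V F \<and> card F \<le> 2 * (k - 1)"
  proof (cases "excess V F = int k")
    case True
    then show ?thesis using F assms(4) unfolding thrifty_def
      by (intro exI[of _ F]) (auto simp: of_nat_diff)
  next
    case False
    then have lt: "excess V F < int k" using F by linarith
    have "F \<union> T = T" using F by blast
    then have "excess V F < excess V (F \<union> T)" using assms(5) lt by simp
    then obtain G where G: "G \<subseteq> T" "raises V F G"
      using excess_gap_imp[OF assms(1) fin assms(3)] raises_single[OF assms(1)] raises_pair[OF assms(1)]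
      by (metis empty_subsetI insert_subset)
    note t = thrifty_Un[OF _ G(2)]
    have "\<not> ?P (F \<union> G)" using max[of "F \<union> G"] t F by force
    then have gt: "int k < excess V (F \<union> G)" using t F G(1) by auto
    have "int (card (F \<union> G)) \<le> int (card F) + 2"
      using G(2) card_Un_le[of F G] unfolding raises_def by linarith
    moreover have "int (card F) \<le> 2 * (excess V F - 1)" using F unfolding thrifty_def by blast
    ultimately have "card (F \<union> G) \<le> 2 * (k - 1)" using lt assms(4) by (simp add: of_nat_diff)
    then show ?thesis using gt F G(1) by (intro exI[of _ "F \<union> G"]) auto
  qed
  then show thesis using that by blast
qed

section \<open>The kernel\<close>

text \<open>Not reflexive: a vertex in no edge is not linked to itself and belongs to no
  component.\<close>

definition linked :: "'a set set \<Rightarrow> 'a \<Rightarrow> 'a \<Rightarrow> bool" where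
  "linked E v w \<longleftrightarrow> (\<exists>f\<in>E. v \<in> f \<and> w \<in> f)"

text \<open>The arguments stand for classes: a singleton for the class of a vertex of X, where
  meeting \<open>e\<close> means membership, and the empty set for the class C, which is treated
  like a vertex of C that \<open>e\<close> misses.\<close>

definition splits :: "'a set \<Rightarrow> 'a set \<Rightarrow> 'a set \<Rightarrow> bool" where
  "splits A B e \<longleftrightarrow> (A \<inter> e \<noteq> {}) \<noteq> (B \<inter> e \<noteq> {})"

definition serves :: "'a set set \<Rightarrow> 'a set \<Rightarrow> 'a set \<Rightarrow> 'a set \<Rightarrow> 'a \<Rightarrow> bool" where
  "serves E C A B v \<longleftrightarrow> (\<exists>e\<in>E. splits A B e \<and> (\<exists>w\<in>e \<inter> C. linked E v w))"

definition points :: "'a set \<Rightarrow> 'a set set" where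
  "points X = insert {} ((\<lambda>x. {x}) ` X)"

text \<open>The situation at the end of the greedy phase when C is too large to be covered by two
  edges. The last assumption with \<open>f = e\<close> also limits single edges.\<close>

locale stuck =
  fixes V :: "'a set" and E T :: "'a set set" and r :: nat
  assumes finV: "finite V" and EV: "E \<subseteq> Pow V" and card_edge: "e \<in> E \<Longrightarrow> card e \<le> r"
    and tc: "test_cover V E" and TE: "T \<subseteq> E" and r_pos: "1 \<le> r"
    and big: "2 * r < card (V - \<Union>T)"
    and stuck: "e \<in> E \<Longrightarrow> f \<in> E \<Longrightarrow> classes V (insert e (insert f T)) \<le> classes V T + 2"
begin

section \<open>Traces of the edges on C: laminarity and components\<close>

abbreviation "X \<equiv> \<Union>T"
abbreviation "C \<equiv> V - X"

lemma finE: "finite E"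
  using EV finV by (meson finite_Pow_iff finite_subset)

lemma edge_sub: "e \<in> E \<Longrightarrow> e \<subseteq> V"
  using EV by blast

lemma finite_edge: "e \<in> E \<Longrightarrow> finite e"
  using edge_sub finV finite_subset by blast

lemma XV: "X \<subseteq> V"
  using TE edge_sub by blast

text \<open>Two edges contain at most 2r vertices, fewer than C. The vertex found here serves as the
  fourth cell of a crossing.\<close>

lemma outside_two:
  assumes "e \<in> E" "f \<in> E"
  obtains d where "d \<in> C" "d \<notin> e" "d \<notin> f"
proof -
  have "card (e \<union> f) < card C"
    using card_edge[OF assms(1)] card_edge[OF assms(2)] card_Un_le[of e f] big by linarith
  then have "\<not> C \<subseteq> e \<union> f"
    using card_mono[of "e \<union> f" C] finite_edge assms by force
  then show thesis using that by blast
qed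

lemma no_cross: "e \<in> E \<Longrightarrow> f \<in> E \<Longrightarrow> \<not> cross V T e f"
  using classes_cross[OF finV, of T e f] stuck[of e f] by fastforce

lemma sig_C: "v \<in> C \<Longrightarrow> sig T v = {}"
  by (auto simp: sig_def)

text \<open>An edge gaining two classes could be completed to a pair gaining three: it leaves at
  least two vertices of C outside, which still share the empty signature, and an edge of E
  separating them adds the third class.\<close>

lemma no_cuts_two:
  assumes e: "e \<in> E"
  shows "\<not> cuts_two V T e"
proof
  assume "cuts_two V T e"
  then have 1: "classes V T + 2 \<le> classes V (insert e T)"
    by (rule classes_cuts_two[OF finV])
  have "card C \<le> card e + card (C - e)"
    using card_Un_le[of e "C - e"] card_mono[of "e \<union> (C - e)" C] finV finite_edge[OF e] by auto
  then have "\<not> card (C - e) \<le> 1" using big card_edge[OF e] r_pos by linarith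
  then obtain u v where uv: "u \<in> C - e" "v \<in> C - e" "u \<noteq> v"
    using card_le_Suc0_iff_eq[of "C - e"] finV by auto
  then obtain f where f: "f \<in> E" "separates f u v"
    using tc unfolding test_cover_def by blast
  have s: "sig (insert e T) u = sig (insert e T) v"
    using uv by (simp add: sig_insert sig_C)
  have "(u \<in> f) \<noteq> (v \<in> f)" using separates_iff[OF uv(3)] f(2) by blast
  then have "classes V (insert e T) + 1 \<le> classes V (insert f (insert e T))"
    using classes_insert_ge1[OF finV, of u v "insert e T" f]
      classes_insert_ge1[OF finV, of v u "insert e T" f] uv s by auto
  then show False using 1 stuck[OF f(1) e] by linarith
qed

text \<open>An edge that meets C also misses a vertex of C, so it cuts the class C. If it cut the
  class of \<open>x\<close> as well, it would cut two classes.\<close>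

lemma sig_cong_edge:
  assumes "e \<in> E" "e \<inter> C \<noteq> {}" "x \<in> X" "y \<in> V" "sig T x = sig T y"
  shows "x \<in> e \<longleftrightarrow> y \<in> e"
proof (rule ccontr)
  assume n: "(x \<in> e) \<noteq> (y \<in> e)"
  obtain b where b: "b \<in> e" "b \<in> C" using assms(2) by blast
  obtain d where d: "d \<in> C" "d \<notin> e" using outside_two assms(1) by metis
  have ne: "sig T x \<noteq> {}" using assms(3) unfolding sig_def by blast
  have xV: "x \<in> V" using assms(3) XV by blast
  have s: "sig T b = sig T d" "sig T x \<noteq> sig T b" "sig T y \<noteq> sig T b"
    using b d ne assms(5) sig_C by auto
  have bd: "b \<in> V" "d \<in> V" using b d by auto
  have "cuts_two V T e"
  proof (cases "x \<in> e")
    case True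
    then have "y \<notin> e" using n by blast
    show ?thesis
      by (rule cuts_twoI[OF xV assms(4) bd assms(5) s(1,2) True \<open>y \<notin> e\<close> b(1) d(2)])
  next
    case False
    then have "y \<in> e" using n by blast
    show ?thesis
      by (rule cuts_twoI[OF assms(4) xV bd assms(5)[symmetric] s(1,3) \<open>y \<in> e\<close> False b(1) d(2)])
  qed
  then show False using no_cuts_two assms(1) by blast
qed

text \<open>If neither trace contained the other, the common vertex \<open>a\<close>, one vertex in
  each difference and a vertex of C outside both edges would make the edges cross in the class
  C.\<close>

lemma laminar:
  assumes "e \<in> E" "f \<in> E" "a \<in> C" "a \<in> e" "a \<in> f"
  shows "e \<inter> C \<subseteq> f \<or> f \<inter> C \<subseteq> e"
proof (rule ccontr)
  assume "\<not> ?thesis"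
  then obtain b c where "b \<in> e" "b \<in> C" "b \<notin> f" "c \<in> f" "c \<in> C" "c \<notin> e" by blast
  moreover obtain d where "d \<in> C" "d \<notin> e" "d \<notin> f" using outside_two assms by metis
  ultimately have "cross V T e f"
    using assms sig_C by (intro crossI[of a _ b c d]) auto
  then show False using no_cross assms by blast
qed

lemma linked_sym: "linked E v w \<Longrightarrow> linked E w v"
  unfolding linked_def by blast

text \<open>Of the two edges through \<open>w\<close>, one contains the trace of the other on C by
  \<open>laminar\<close>, and so contains both \<open>v\<close> and \<open>u\<close>.\<close>

lemma linked_trans:
  assumes "w \<in> C" "u \<in> C" "v \<in> C" "linked E v w" "linked E w u"
  shows "linked E v u"
proof -
  obtain f g where "f \<in> E" "v \<in> f" "w \<in> f" "g \<in> E" "w \<in> g" "u \<in> g"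
    using assms(4,5) unfolding linked_def by blast
  then show ?thesis using laminar[of f g w] assms unfolding linked_def by blast
qed

text \<open>The traces of the edges through \<open>m\<close> form a chain, so an edge with the
  largest trace contains the whole component of \<open>m\<close>.\<close>

lemma card_linked:
  assumes "m \<in> C"
  shows "card {w \<in> C. linked E m w} \<le> r"
proof (cases "\<exists>f\<in>E. m \<in> f")
  case False
  then have "{w \<in> C. linked E m w} = {}" unfolding linked_def by blast
  then show ?thesis by (simp only: card.empty)
next
  case True
  then obtain f where "f \<in> E \<and> m \<in> f" by blast
  then obtain g where "g \<in> E \<and> m \<in> g"
    and "\<And>f. f \<in> E \<and> m \<in> f \<Longrightarrow> int (card (f \<inter> C)) \<le> int (card (g \<inter> C))"
    by (rule exists_max_int[where P = "\<lambda>f. f \<in> E \<and> m \<in> f"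
          and f = "\<lambda>f. int (card (f \<inter> C))" and b = "int (card V)"])
      (use finV edge_sub in \<open>auto intro: card_mono\<close>)
  then have g: "g \<in> E" "m \<in> g"
    and gmax: "\<And>f. f \<in> E \<Longrightarrow> m \<in> f \<Longrightarrow> card (f \<inter> C) \<le> card (g \<inter> C)" by auto
  have "{w \<in> C. linked E m w} \<subseteq> g"
  proof
    fix w assume "w \<in> {w \<in> C. linked E m w}"
    then obtain f where f: "f \<in> E" "m \<in> f" "w \<in> f" "w \<in> C" unfolding linked_def by blast
    consider "f \<inter> C \<subseteq> g" | "g \<inter> C \<subseteq> f" using laminar[OF f(1) g(1) assms f(2) g(2)] by blast
    then show "w \<in> g"
    proof cases
      case 2
      then have "g \<inter> C \<subseteq> f \<inter> C" by blast
      then have "g \<inter> C = f \<inter> C"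
        using card_seteq[of "f \<inter> C" "g \<inter> C"] gmax[OF f(1,2)] finite_edge[OF f(1)] by blast
      then show ?thesis using f by blast
    qed (use f in blast)
  qed
  then have "card {w \<in> C. linked E m w} \<le> card g" using finite_edge[OF g(1)] card_mono by blast
  then show ?thesis using card_edge[OF g(1)] by linarith
qed

text \<open>Edges meeting C do not distinguish equivalent vertices of X, so only classes of points
  matter. A vertex of X lies in an edge of T, hence the empty point is equivalent to no
  singleton.\<close>

lemma serves_cong:
  assumes "A \<in> points X" "A' \<in> points X" "B \<in> points X" "B' \<in> points X"
    "{e \<in> T. A \<inter> e \<noteq> {}} = {e \<in> T. A' \<inter> e \<noteq> {}}"
    "{e \<in> T. B \<inter> e \<noteq> {}} = {e \<in> T. B' \<inter> e \<noteq> {}}"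
  shows "serves E C A B v \<longleftrightarrow> serves E C A' B' v"
proof -
  have *: "(A \<inter> e \<noteq> {}) = (A' \<inter> e \<noteq> {})"
    if A: "A \<in> points X" "A' \<in> points X" "{e \<in> T. A \<inter> e \<noteq> {}} = {e \<in> T. A' \<inter> e \<noteq> {}}"
      and e: "e \<in> E" "e \<inter> C \<noteq> {}" for A A' e
  proof (cases "A = {} \<or> A' = {}")
    case True
    then have "A = {} \<and> A' = {}" using A unfolding points_def by auto
    then show ?thesis by simp
  next
    case False
    then obtain x y where xy: "A = {x}" "A' = {y}" "x \<in> X" "y \<in> X"
      using A unfolding points_def by auto
    then have "sig T x = sig T y" using A(3) unfolding sig_def by auto
    then show ?thesis using sig_cong_edge[OF e xy(3)] xy XV by auto
  qed
  have "splits A B e \<longleftrightarrow> splits A' B' e" if "e \<in> E" "e \<inter> C \<noteq> {}" for e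
    using *[OF assms(1,2,5) that] *[OF assms(3,4,6) that] unfolding splits_def by simp
  then show ?thesis unfolding serves_def by blast
qed

text \<open>The empty point has the same signature as the vertices of C, which is nonempty, so it
  introduces no class beyond those counted in V. This is what makes the number of relevant pairs
  depend on k and not on |X|.\<close>

lemma card_point_sigs: "card ((\<lambda>A. {e \<in> T. A \<inter> e \<noteq> {}}) ` points X) \<le> classes V T"
proof -
  have "C \<noteq> {}" using big by (metis card.empty not_less_zero)
  then obtain d where d: "d \<in> C" by blast
  have "(\<lambda>A. {e \<in> T. A \<inter> e \<noteq> {}}) ` points X \<subseteq> sig T ` V"
  proof
    fix s assume "s \<in> (\<lambda>A. {e \<in> T. A \<inter> e \<noteq> {}}) ` points X"
    then consider "s = {}" | x where "x \<in> X" "s = {e \<in> T. x \<in> e}"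
      unfolding points_def by auto
    then show "s \<in> sig T ` V"
    proof cases
      case 1
      then show ?thesis using d sig_C by (metis DiffD1 image_eqI)
    next
      case 2
      then show ?thesis using XV unfolding sig_def by blast
    qed
  qed
  then show ?thesis unfolding classes_def using finV by (intro card_mono) auto
qed

end

text \<open>R has one leader for each component and M contains the leaders of the kept ones.
  \<open>M_rich\<close> says that a dropped component serves only pairs that are served by at least
  4k kept ones.\<close>

locale kernel = stuck +
  fixes k :: nat and R M :: "'a set"
  assumes k_pos: "1 \<le> k"
    and leaders_C: "R \<subseteq> C"
    and leaders_cover: "v \<in> C \<Longrightarrow> linked E v v \<Longrightarrow> \<exists>l\<in>R. linked E l v"
    and leaders_unique: "l \<in> R \<Longrightarrow> l' \<in> R \<Longrightarrow> linked E l l' \<Longrightarrow> l = l'"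
    and M_sub: "M \<subseteq> R"
    and M_rich: "A \<in> points X \<Longrightarrow> B \<in> points X \<Longrightarrow> l \<in> R \<Longrightarrow> l \<notin> M \<Longrightarrow> serves E C A B l \<Longrightarrow>
      4 * k \<le> card {m \<in> M. serves E C A B m}"
begin

section \<open>Kept vertices and edges as an instance of their own\<close>

definition kept :: "'a set" where
  "kept = {w \<in> C. \<exists>m\<in>M. linked E m w}"

definition E' :: "'a set set" where
  "E' = {e \<in> E. e \<inter> C \<subseteq> kept}"

lemma finM: "finite M"
  using M_sub leaders_C finV by (meson finite_Diff finite_subset)

lemma E'_sub: "E' \<subseteq> E"
  unfolding E'_def by blast

lemma TE': "T \<subseteq> E'"
  using TE unfolding E'_def by blast

lemma kept_linked: "v \<in> kept \<Longrightarrow> w \<in> C \<Longrightarrow> linked E v w \<Longrightarrow> w \<in> kept"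
  using linked_trans M_sub leaders_C unfolding kept_def by blast

text \<open>The trace of an edge on C lies in one component, so a single kept vertex decides for the
  whole edge.\<close>

lemma in_E'I: "e \<in> E \<Longrightarrow> v \<in> e \<Longrightarrow> v \<in> kept \<Longrightarrow> e \<in> E'"
  using kept_linked unfolding E'_def linked_def by blast

lemma notin_E'E:
  assumes "e \<in> E" "e \<notin> E'"
  obtains b where "b \<in> e" "b \<in> C" "b \<notin> kept"
  using assms unfolding E'_def by blast

lemma notin_E'_kept: "e \<in> E \<Longrightarrow> e \<notin> E' \<Longrightarrow> v \<in> e \<Longrightarrow> v \<notin> kept"
  using in_E'I by blast

text \<open>Vertices of X that are separated by a dropped edge are also separated by T, by
  \<open>sig_cong_edge\<close>. A kept vertex lies in an edge, and this edge avoids all dropped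
  vertices. At most one dropped vertex \<open>z\<close> is present, so dropped vertices need not be
  told apart.\<close>

lemma kernel_test_cover:
  assumes "V' \<subseteq> V" "V' \<inter> C \<subseteq> insert z kept"
  shows "test_cover V' E'"
proof -
  have "\<exists>e\<in>E'. v \<in> e \<and> w \<notin> e" if v: "v \<in> V'" and w: "w \<in> V'" and "v \<in> kept" "w \<notin> kept" "w \<in> C" for v w
  proof -
    have "linked E v v" using that(3) unfolding kept_def linked_def by blast
    then obtain f where "f \<in> E" "v \<in> f" unfolding linked_def by blast
    then show ?thesis using that(3-) in_E'I[of f v] unfolding E'_def by blast
  qed note kept_out = this
  have "\<exists>e\<in>E'. (v \<in> e) \<noteq> (w \<in> e)" if vw: "v \<in> V'" "w \<in> V'" "v \<noteq> w" for v w
  proof -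
    consider "v \<in> X" "w \<in> X" | "v \<in> X" "w \<in> C" | "v \<in> C" "w \<in> X"
      | "v \<in> kept" "w \<in> kept" | "v \<in> kept" "w \<in> C" "w \<notin> kept" | "w \<in> kept" "v \<in> C" "v \<notin> kept"
      using vw assms by blast
    then show ?thesis
    proof cases
      case 1
      obtain e where e: "e \<in> E" "separates e v w"
        using vw assms(1) tc unfolding test_cover_def by blast
      then have ne: "(v \<in> e) \<noteq> (w \<in> e)" using separates_iff vw(3) by metis
      show ?thesis
      proof (cases "e \<inter> C = {}")
        case True
        then show ?thesis using e ne unfolding E'_def by blast
      next
        case False
        then have "sig T v \<noteq> sig T w" using sig_cong_edge[OF e(1) False 1(1)] 1 vw assms(1) ne by blast
        then show ?thesis using TE' unfolding sig_def by blast
      qed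
    next
      case 4
      obtain e where e: "e \<in> E" "separates e v w"
        using vw assms(1) tc unfolding test_cover_def by blast
      then have ne: "(v \<in> e) \<noteq> (w \<in> e)" using separates_iff vw(3) by metis
      then show ?thesis using e(1) in_E'I 4 by blast
    next
      case 2
      then obtain f where "f \<in> T" "v \<in> f" by blast
      then show ?thesis using 2 TE' by blast
    next
      case 3
      then obtain f where "f \<in> T" "w \<in> f" by blast
      then show ?thesis using 3 TE' by blast
    next
      case 5
      show ?thesis using kept_out[OF vw(1,2) 5(1,3,2)] by blast
    next
      case 6
      show ?thesis using kept_out[OF vw(2,1) 6(1,3,2)] by blast
    qed
  qed
  then show ?thesis unfolding test_cover_def using separates_iff by metis
qed

text \<open>The component met by the dropped edge \<open>e\<close> has a leader outside M, so at
  least 4k kept components serve the pair. G meets at most |G| of them, and three are left: two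
  supply edges, the third a vertex outside both.\<close>

lemma fresh_edges:
  assumes e: "e \<in> E" "e \<notin> E'" and AB: "A \<in> points X" "B \<in> points X" "splits A B e"
    and G: "G \<subseteq> E" "card G + 3 \<le> 4 * k"
  obtains e1 e2 w1 w2 w3 where "e1 \<in> E'" "e2 \<in> E'" "splits A B e1" "splits A B e2"
    "w1 \<in> C" "w2 \<in> C" "w3 \<in> C" "sig G w1 = {}" "sig G w2 = {}" "sig G w3 = {}"
    "w1 \<in> e1" "w1 \<notin> e2" "w2 \<in> e2" "w2 \<notin> e1" "w3 \<notin> e1" "w3 \<notin> e2"
    "\<And>g. g \<in> G \<Longrightarrow> g \<inter> C \<inter> e1 = {}"
proof -
  obtain b where b: "b \<in> e" "b \<in> C" "b \<notin> kept" using notin_E'E[OF e] .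
  obtain l where l: "l \<in> R" "linked E l b"
    using leaders_cover[OF b(2)] b(1) e(1) unfolding linked_def by blast
  have "l \<notin> M" using l b unfolding kept_def by blast
  moreover have "serves E C A B l" using e(1) b l AB(3) unfolding serves_def by blast
  ultimately have rich: "4 * k \<le> card {m \<in> M. serves E C A B m}" using M_rich AB l(1) by blast
  define U where "U = {m \<in> M. \<exists>g\<in>G. \<exists>u\<in>g \<inter> C. linked E m u}"
  have finG: "finite G" using G(1) finE finite_subset by blast
  have "card U \<le> card G"
  proof -
    \<comment> \<open>\<open>h\<close> charges a leader whose component is met by G to an edge of G.
      The trace of that edge lies in a single component, so no edge is charged twice.\<close>
    define h where "h m = (SOME g. g \<in> G \<and> (\<exists>u\<in>g \<inter> C. linked E m u))" for m
    have h: "h m \<in> G \<and> (\<exists>u\<in>h m \<inter> C. linked E m u)" if "m \<in> U" for m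
    proof -
      have "\<exists>g. g \<in> G \<and> (\<exists>u\<in>g \<inter> C. linked E m u)" using that unfolding U_def by blast
      from someI_ex[OF this] show ?thesis unfolding h_def .
    qed
    have "inj_on h U"
    proof (rule inj_onI)
      fix m m' assume m: "m \<in> U" "m' \<in> U" "h m = h m'"
      obtain u u' where u: "u \<in> h m \<inter> C" "linked E m u" "u' \<in> h m \<inter> C" "linked E m' u'"
        using h[OF m(1)] h[OF m(2)] m(3) by auto
      have mR: "m \<in> R" "m' \<in> R" "m \<in> C" "m' \<in> C" using m M_sub leaders_C unfolding U_def by blast+
      have "h m \<in> E" using h[OF m(1)] G(1) by blast
      then have "linked E u u'" using u unfolding linked_def by blast
      then have "linked E m m'"
        using linked_trans[of u u' m] linked_trans[of u' m' m] linked_sym u mR by blast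
      then show "m = m'" using leaders_unique mR by blast
    qed
    moreover have "h ` U \<subseteq> G" using h by blast
    ultimately show ?thesis using finG card_inj_on_le by blast
  qed
  then have "3 \<le> card ({m \<in> M. serves E C A B m} - U)"
    using rich G(2) diff_card_le_card_Diff[of U "{m \<in> M. serves E C A B m}"] finM
    unfolding U_def by fastforce
  then obtain ms where "ms \<subseteq> {m \<in> M. serves E C A B m} - U" "card ms = 3"
    using obtain_subset_with_card_n by metis
  then obtain m1 m2 m3 where m: "{m1, m2, m3} \<subseteq> {m \<in> M. serves E C A B m} - U"
    "m1 \<noteq> m2" "m1 \<noteq> m3" "m2 \<noteq> m3"
    by (metis card_3_iff)
  have ex: "\<exists>e w. e \<in> E' \<and> splits A B e \<and> w \<in> e \<and> w \<in> C \<and> linked E m w \<and> sig G w = {} \<and>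
      (\<forall>v\<in>e \<inter> C. linked E m v) \<and> (\<forall>g\<in>G. g \<inter> C \<inter> e = {})" if "m \<in> {m1, m2, m3}" for m
  proof -
    have mm: "m \<in> M" "serves E C A B m" "m \<notin> U" "m \<in> C" using m that M_sub leaders_C by auto
    then obtain e w where ew: "e \<in> E" "splits A B e" "w \<in> e" "w \<in> C" "linked E m w"
      unfolding serves_def by blast
    have "w \<in> kept" using ew mm unfolding kept_def by blast
    then have "e \<in> E'" using in_E'I ew by blast
    moreover have all: "\<forall>v\<in>e \<inter> C. linked E m v"
      using linked_trans[of w _ m] ew mm unfolding linked_def by blast
    moreover have "\<forall>g\<in>G. g \<inter> C \<inter> e = {}" using all mm unfolding U_def by blast
    moreover have "sig G w = {}" using ew mm unfolding U_def sig_def by blast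
    ultimately show ?thesis using ew by blast
  qed
  obtain e1 w1 where 1: "e1 \<in> E'" "splits A B e1" "w1 \<in> e1" "w1 \<in> C" "linked E m1 w1" "sig G w1 = {}"
      "\<forall>v\<in>e1 \<inter> C. linked E m1 v" "\<forall>g\<in>G. g \<inter> C \<inter> e1 = {}"
    using ex[of m1, OF insertI1] by (elim exE conjE) (rule that)
  obtain e2 w2 where 2: "e2 \<in> E'" "splits A B e2" "w2 \<in> e2" "w2 \<in> C" "linked E m2 w2" "sig G w2 = {}"
      "\<forall>v\<in>e2 \<inter> C. linked E m2 v"
    using ex[of m2, OF insertI2[OF insertI1]] by (elim exE conjE) (rule that)
  obtain w3 where 3: "w3 \<in> C" "linked E m3 w3" "sig G w3 = {}"
    using ex[of m3, OF insertI2[OF insertI2[OF insertI1]]] by (elim exE conjE) (rule that)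
  have mR: "m1 \<in> R" "m2 \<in> R" "m3 \<in> R" "m1 \<in> C" "m2 \<in> C" "m3 \<in> C" using m M_sub leaders_C by auto
  have sep: False if "linked E a w" "linked E b w" "w \<in> C" "a \<in> R" "b \<in> R" "a \<noteq> b" for a b w
    using linked_trans[of w b a] linked_sym that leaders_unique leaders_C by blast
  have "w1 \<notin> e2" using sep[of m1 w1 m2] 1 2 mR m(2) by blast
  moreover have "w2 \<notin> e1" using sep[of m2 w2 m1] 1 2 mR m(2) by blast
  moreover have "w3 \<notin> e1" using sep[of m3 w3 m1] 1 3 mR m(3) by blast
  moreover have "w3 \<notin> e2" using sep[of m3 w3 m2] 2 3 mR m(4) by blast
  ultimately show thesis by (rule that[OF 1(1) 2(1) 1(2) 2(2) 1(4) 2(4) 3(1) 1(6) 2(6) 3(3) 1(3) _ 2(3)]) (use 1(8) in blast)+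
qed

section \<open>Exchanging dropped edges for kept ones\<close>

lemma points_sing: "x \<in> X \<Longrightarrow> {x} \<in> points X"
  and points_empty: "{} \<in> points X"
  unfolding points_def by auto

lemma splits_sing: "splits {x} {} e \<longleftrightarrow> x \<in> e" "splits {x} {y} e \<longleftrightarrow> (x \<in> e) \<noteq> (y \<in> e)"
  unfolding splits_def by auto

text \<open>
  An edge outside the kernel is useful either because it contains a vertex of \<open>X\<close> that no edge
  of \<open>F\<close> covers, or because it separates a vertex of \<open>X\<close> from an equivalent covered one.
\<close>

lemma replace_at_uncovered:
  assumes "F \<subseteq> E'" "S \<subseteq> E" "card (F \<union> S) + 3 \<le> 4 * k"
    and e: "e \<in> E" "e \<notin> E'" "x \<in> e" "x \<in> X" "sig F x = {}"
  obtains G where "G \<subseteq> E'" "raises V F G" "excess V (F \<union> S) \<le> excess V (F \<union> G \<union> S)"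
proof -
  have FS: "F \<union> S \<subseteq> E" using assms(1,2) E'_sub by blast
  obtain e1 e2 w1 w2 w3 where ew: "e1 \<in> E'" "e2 \<in> E'" "x \<in> e1" "x \<in> e2"
    "w1 \<in> C" "w2 \<in> C" "w3 \<in> C" "sig (F \<union> S) w1 = {}" "sig (F \<union> S) w2 = {}" "sig (F \<union> S) w3 = {}"
    "w1 \<in> e1" "w1 \<notin> e2" "w2 \<in> e2" "w2 \<notin> e1" "w3 \<notin> e1" "w3 \<notin> e2"
    by (rule fresh_edges[OF e(1,2) points_sing[OF e(4)] points_empty _ FS assms(3)])
      (use e(3) in \<open>auto simp: splits_sing\<close>)
  have s: "sig F w1 = {}" "sig F w2 = {}" "sig F w3 = {}"
    using ew(8-10)[THEN sig_empty_mono] by auto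
  \<comment> \<open>\<open>x\<close>, \<open>w1\<close>, \<open>w2\<close> and \<open>w3\<close>
    inhabit the four cells within the class of vertices that F leaves uncovered.\<close>
  have "cross V F e1 e2"
    by (rule crossI[of x V w1 w2 w3]) (use ew e s XV in auto)
  then have r: "raises V F {e1, e2}" by (rule raises_pair[OF finV])
  \<comment> \<open>Relative to F \<union> S each new edge separates its own vertex,
    \<open>w1\<close> or \<open>w2\<close>, from \<open>w3\<close> and so pays for itself.\<close>
  have "classes V (F \<union> S) + 1 \<le> classes V (insert e1 (F \<union> S))"
    by (rule classes_insert_ge1[OF finV, of w1 w3]) (use ew in auto)
  moreover have "classes V (insert e1 (F \<union> S)) + 1 \<le> classes V (insert e2 (insert e1 (F \<union> S)))"
    by (rule classes_insert_ge1[OF finV, of w2 w3]) (use ew in \<open>auto simp: sig_insert\<close>)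
  moreover have "card (insert e2 (insert e1 (F \<union> S))) \<le> card (F \<union> S) + 2"
    using finite_subset[OF FS finE] by (simp add: card_insert_if)
  ultimately have "excess V (F \<union> S) \<le> excess V (insert e2 (insert e1 (F \<union> S)))"
    unfolding excess_def by linarith
  moreover have "F \<union> {e1, e2} \<union> S = insert e2 (insert e1 (F \<union> S))" by blast
  ultimately have "excess V (F \<union> S) \<le> excess V (F \<union> {e1, e2} \<union> S)" by metis
  then show thesis using that[of "{e1, e2}"] r ew by blast
qed

text \<open>One fresh edge is enough: it cuts the class of \<open>x\<close> and \<open>y\<close>,
  and with \<open>w1\<close> and \<open>w3\<close> also the class of uncovered vertices. The vertex
  \<open>x\<close> must lie in X, since a vertex of C covered by F is kept and cannot lie in the
  dropped edge \<open>e\<close>.\<close>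

lemma replace_at_covered:
  assumes F: "F \<subseteq> E'" "S \<subseteq> E" "card (F \<union> S) + 3 \<le> 4 * k"
    and e: "e \<in> E" "e \<notin> E'" "x \<in> e" "y \<in> V" "y \<notin> e" "sig F x = sig F y" "sig F x \<noteq> {}"
  obtains G where "G \<subseteq> E'" "raises V F G" "excess V (F \<union> S) \<le> excess V (F \<union> G \<union> S)"
proof -
  have FS: "F \<union> S \<subseteq> E" using F(1,2) E'_sub by blast
  obtain g where g: "g \<in> F" "x \<in> g" "y \<in> g"
    using e(6,7) sig_eqD[OF e(6)] unfolding sig_def by blast
  have "x \<in> V" using e(1,3) edge_sub by blast
  have "x \<in> X"
  proof (rule ccontr)
    assume "x \<notin> X"
    then have "x \<in> kept" using g F(1) \<open>x \<in> V\<close> unfolding E'_def by blast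
    then show False using notin_E'_kept e by blast
  qed
  \<comment> \<open>A vertex \<open>y\<close> in C is represented by the empty set. The fresh edge
    avoids the trace of the edge of F that covers \<open>y\<close>, so it misses \<open>y\<close>,
    as this representation presumes.\<close>
  define B where "B = (if y \<in> X then {y} else {})"
  have B: "B \<in> points X" "splits {x} B e"
    using e(3,5) points_sing points_empty unfolding B_def by (auto simp: splits_sing)
  obtain e1 w1 w3 where ew: "e1 \<in> E'" "splits {x} B e1"
    "w1 \<in> C" "w3 \<in> C" "sig (F \<union> S) w1 = {}" "sig (F \<union> S) w3 = {}"
    "w1 \<in> e1" "w3 \<notin> e1" "\<And>g. g \<in> F \<union> S \<Longrightarrow> g \<inter> C \<inter> e1 = {}"
    by (rule fresh_edges[OF e(1,2) points_sing[OF \<open>x \<in> X\<close>] B FS F(3)]) blast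
  have ne: "(x \<in> e1) \<noteq> (y \<in> e1)"
  proof (cases "y \<in> X")
    case True
    then show ?thesis using ew(2) unfolding B_def by (simp add: splits_sing)
  next
    case False
    then have "y \<notin> e1" using g ew(9)[of g] e(4) by blast
    then show ?thesis using ew(2) False unfolding B_def by (simp add: splits_sing)
  qed
  have s: "sig F w1 = {}" "sig F w3 = {}" using ew(5,6)[THEN sig_empty_mono] by auto
  have w: "w1 \<in> V" "w3 \<in> V" using ew(3,4) by auto
  have "cuts_two V F e1"
  proof (cases "x \<in> e1")
    case True
    then show ?thesis
      by (intro cuts_twoI[of x V y w1 w3]) (use ne e w s ew(7,8) \<open>x \<in> V\<close> in auto)
  next
    case False
    then show ?thesis
      by (intro cuts_twoI[of y V x w1 w3]) (use ne e w s ew(7,8) \<open>x \<in> V\<close> in auto)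
  qed
  then have r: "raises V F {e1}" by (rule raises_single[OF finV])
  have "classes V (F \<union> S) + 1 \<le> classes V (insert e1 (F \<union> S))"
    by (rule classes_insert_ge1[OF finV w]) (use ew in auto)
  moreover have "card (insert e1 (F \<union> S)) \<le> card (F \<union> S) + 1"
    using finite_subset[OF FS finE] by (simp add: card_insert_if)
  ultimately have "excess V (F \<union> S) \<le> excess V (insert e1 (F \<union> S))"
    unfolding excess_def by linarith
  moreover have "F \<union> {e1} \<union> S = insert e1 (F \<union> S)" by blast
  ultimately have "excess V (F \<union> S) \<le> excess V (F \<union> {e1} \<union> S)" by metis
  then show thesis using that[of "{e1}"] r ew by blast
qed

lemma sig_notin_kept:
  assumes "F \<subseteq> E'" "v \<in> C" "v \<notin> kept"
  shows "sig F v = {}"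
  using assms unfolding E'_def sig_def by blast

text \<open>An edge of the kernel can move into F unchanged. For a dropped edge, at most one of the
  two cut classes is that of the uncovered vertices, and the other one falls under
  \<open>replace_at_covered\<close>.\<close>

lemma replace_cuts_two:
  assumes F: "F \<subseteq> E'" "S \<subseteq> E" "card (F \<union> S) + 3 \<le> 4 * k"
    and e: "e \<in> S" "cuts_two V F e"
  obtains G where "G \<subseteq> E'" "raises V F G" "excess V (F \<union> S) \<le> excess V (F \<union> G \<union> S)"
proof (cases "e \<in> E'")
  case True
  moreover have "F \<union> {e} \<union> S = F \<union> S" using e by blast
  ultimately show ?thesis using that[of "{e}"] raises_single[OF finV e(2)] by simp
next
  case False
  obtain x y x' y' where *: "x \<in> V" "y \<in> V" "x' \<in> V" "y' \<in> V"
    "sig F x = sig F y" "sig F x' = sig F y'" "sig F x \<noteq> sig F x'"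
    "x \<in> e" "y \<notin> e" "x' \<in> e" "y' \<notin> e"
    using e(2) unfolding cuts_two_def by blast
  have eE: "e \<in> E" using e F by blast
  show ?thesis
  proof (cases "sig F x = {}")
    case True
    then have "sig F x' \<noteq> {}" using *(7) by simp
    then show ?thesis by (rule replace_at_covered[OF F eE False *(10,4,11,6) _ that])
  next
    case n: False
    show ?thesis by (rule replace_at_covered[OF F eE False *(8,2,9,5) n that])
  qed
qed

text \<open>If the crossing happens in a covered class, the cut by \<open>e\<close> alone suffices.
  In the uncovered class, one of \<open>a\<close>, \<open>b\<close>, \<open>c\<close> must lie in X,
  since otherwise the traces on C would not be laminar.\<close>

lemma replace_cross_outside:
  assumes F: "F \<subseteq> E'" "S \<subseteq> E" "card (F \<union> S) + 3 \<le> 4 * k"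
    and e: "e \<in> S" "f \<in> S" "cross V F e f" "e \<notin> E'"
  obtains G where "G \<subseteq> E'" "raises V F G" "excess V (F \<union> S) \<le> excess V (F \<union> G \<union> S)"
proof -
  obtain a b c d where *: "a \<in> V" "b \<in> V" "c \<in> V" "d \<in> V"
    "sig F a = sig F b" "sig F a = sig F c" "sig F a = sig F d"
    "a \<in> e" "a \<in> f" "b \<in> e" "b \<notin> f" "c \<notin> e" "c \<in> f" "d \<notin> e" "d \<notin> f"
    using e(3) by (rule crossE)
  have eE: "e \<in> E" "f \<in> E" using e F by blast+
  show thesis
  proof (cases "sig F a = {}")
    case False
    show ?thesis by (rule replace_at_covered[OF F eE(1) e(4) *(8,4,14,7) False that])
  next
    case True
    then have s: "sig F a = {}" "sig F b = {}" "sig F c = {}" using * by auto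
    show ?thesis
    proof (cases "a \<in> X \<or> b \<in> X")
      case True
      then show ?thesis
      proof
        assume x: "a \<in> X"
        show ?thesis by (rule replace_at_uncovered[OF F eE(1) e(4) *(8) x s(1) that])
      next
        assume x: "b \<in> X"
        show ?thesis by (rule replace_at_uncovered[OF F eE(1) e(4) *(10) x s(2) that])
      qed
    next
      case n: False
      then have ab: "a \<in> C" "b \<in> C" using * by auto
      have "a \<notin> kept" using notin_E'_kept eE(1) e(4) *(8) by blast
      \<comment> \<open>The dropped vertex \<open>a\<close> lies in \<open>f\<close> as well, so
        \<open>f\<close> is also outside the kernel and can be replaced at \<open>c\<close>.\<close>
      then have f: "f \<notin> E'" using ab(1) *(9) unfolding E'_def by blast
      show ?thesis
      proof (cases "c \<in> X")
        case True
        show ?thesis by (rule replace_at_uncovered[OF F eE(2) f *(13) True s(3) that])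
      next
        case False
        then have "c \<in> C" using * by auto
        then show ?thesis using laminar[OF eE ab(1) *(8,9)] ab * by blast
      qed
    qed
  qed
qed

lemma replace_cross:
  assumes F: "F \<subseteq> E'" "S \<subseteq> E" "card (F \<union> S) + 3 \<le> 4 * k"
    and e: "e \<in> S" "f \<in> S" "cross V F e f"
  obtains G where "G \<subseteq> E'" "raises V F G" "excess V (F \<union> S) \<le> excess V (F \<union> G \<union> S)"
proof -
  consider "e \<notin> E'" | "f \<notin> E'" | "e \<in> E'" "f \<in> E'" by blast
  then show thesis
  proof cases
    case 1
    show ?thesis by (rule replace_cross_outside[OF F e 1 that])
  next
    case 2
    show ?thesis by (rule replace_cross_outside[OF F e(2,1) cross_sym[OF e(3)] 2 that])
  next
    case 3
    have "F \<union> {e, f} \<union> S = F \<union> S" using e by blast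
    then show ?thesis using that[of "{e, f}"] raises_pair[OF finV e(3)] 3 by simp
  qed
qed

text \<open>F is chosen with the greatest excess among the thrifty subsets of the kernel for which F
  \<union> S' still reaches k. If F itself fell short, a step of S' would raise its excess, and the
  replacement of this step in the kernel would contradict the choice.\<close>

lemma excess_in_kernel:
  assumes "S \<subseteq> E" "int k \<le> excess V S"
  obtains F where "F \<subseteq> E'" "int k \<le> excess V F"
proof -
  have ne: "V \<noteq> {}" using big by (metis card.empty empty_Diff not_less_zero)
  obtain S' where S': "S' \<subseteq> S" "int k \<le> excess V S'" "card S' \<le> 2 * (k - 1)"
    by (rule small_subset_with_excess[OF finV ne finite_subset[OF assms(1) finE] k_pos assms(2)])
  have S'E: "S' \<subseteq> E" using S'(1) assms(1) by blast
  have finS': "finite S'" by (rule finite_subset[OF S'E finE])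
  let ?P = "\<lambda>F. F \<subseteq> E' \<and> thrifty V F \<and> int k \<le> excess V (F \<union> S')"
  have "?P {}" using S'(2) thrifty_empty[OF ne] by simp
  then obtain F where F: "?P F" and max: "\<And>G. ?P G \<Longrightarrow> excess V G \<le> excess V F"
    by (rule exists_max_int[where P = ?P and f = "excess V" and b = "int (card V)"])
      (use excess_le_card[OF finV] in auto)
  have FE': "F \<subseteq> E'" and th: "thrifty V F" and FS: "int k \<le> excess V (F \<union> S')" using F by blast+
  have finF: "finite F" using th unfolding thrifty_def by blast
  have "int k \<le> excess V F"
  proof (rule ccontr)
    assume lt: "\<not> int k \<le> excess V F"
    then have "excess V F < excess V (F \<union> S')" using FS by linarith
    note gap = excess_gap_imp[OF finV finF finS' this]
    have "excess V F \<le> int k - 1" using lt by linarith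
    then have "2 * (excess V F - 1) \<le> 2 * (int k - 2)" by simp
    then have "int (card F) \<le> 2 * (int k - 2)"
      using th[unfolded thrifty_def, THEN conjunct2] by (rule order_trans[rotated])
    then have "int (card F + 4) \<le> int (2 * k)" by simp
    then have "card F + 4 \<le> 2 * k" by (simp only: of_nat_le_iff)
    moreover have "card S' + 2 \<le> 2 * k" using S'(3) k_pos by simp
    \<comment> \<open>At most 2k-4 edges of F and 2k-2 edges of S' make 4k-6, three less than the
      permitted 4k-3.\<close>
    ultimately have c: "card (F \<union> S') + 3 \<le> 4 * k"
      using card_Un_le[of F S'] by linarith
    obtain G where G: "G \<subseteq> E'" "raises V F G" "excess V (F \<union> S') \<le> excess V (F \<union> G \<union> S')"
    proof (rule gap)
      fix e assume e: "e \<in> S'" "cuts_two V F e"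
      show thesis by (rule replace_cuts_two[OF FE' S'E c e that])
    next
      fix e f assume e: "e \<in> S'" "f \<in> S'" "cross V F e f"
      show thesis by (rule replace_cross[OF FE' S'E c e that])
    qed
    note t = thrifty_Un[OF th G(2)]
    have "?P (F \<union> G)" using t(1) G FE' FS by auto
    then have "excess V (F \<union> G) \<le> excess V F" by (rule max)
    then show False using t(2) by linarith
  qed
  then show thesis using that FE' by blast
qed

text \<open>For edges of the kernel all dropped vertices have the empty signature, so the one vertex
  \<open>z\<close> preserves their class and the excess is the same on V' and V.\<close>

lemma kernel_excess_iff:
  assumes V': "V' \<subseteq> V" "X \<subseteq> V'" "V' \<inter> C \<subseteq> insert z kept" "kept \<subseteq> V'"
    and z: "C \<subseteq> kept \<or> z \<in> V' \<inter> C - kept"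
  shows "(\<exists>F\<subseteq>E'. int k \<le> excess V' F) \<longleftrightarrow> (\<exists>F\<subseteq>E. int k \<le> excess V F)"
proof -
  have sigs: "sig F ` V' = sig F ` V" if "F \<subseteq> E'" for F
  proof
    show "sig F ` V \<subseteq> sig F ` V'"
    proof
      fix s assume "s \<in> sig F ` V"
      then obtain v where v: "v \<in> V" "s = sig F v" by blast
      show "s \<in> sig F ` V'"
      proof (cases "v \<in> V'")
        case False
        then have vC: "v \<in> C" "v \<notin> kept" using v V' by auto
        then have "z \<in> V'" "z \<in> C" "z \<notin> kept" using z by auto
        moreover have "s = {}" using sig_notin_kept[OF that vC] v by simp
        ultimately show ?thesis using sig_notin_kept[OF that] by (metis image_eqI)
      qed (use v in blast)
    qed
  qed (use V' in blast)
  have ex: "excess V' F = excess V F" if "F \<subseteq> E'" for F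
    using sigs[OF that] unfolding excess_def classes_def by simp
  show ?thesis
  proof
    assume "\<exists>F\<subseteq>E'. int k \<le> excess V' F"
    then obtain F where "F \<subseteq> E'" "int k \<le> excess V' F" by blast
    then show "\<exists>F\<subseteq>E. int k \<le> excess V F" using ex[of F] E'_sub by auto
  next
    assume "\<exists>F\<subseteq>E. int k \<le> excess V F"
    then obtain S where "S \<subseteq> E" "int k \<le> excess V S" by blast
    then obtain F where "F \<subseteq> E'" "int k \<le> excess V F" by (rule excess_in_kernel)
    then show "\<exists>F\<subseteq>E'. int k \<le> excess V' F" using ex[of F] by auto
  qed
qed

lemma card_kept: "card kept \<le> card M * r"
proof -
  have "kept = (\<Union>m\<in>M. {w \<in> C. linked E m w})" unfolding kept_def by blast
  then have "card kept \<le> (\<Sum>m\<in>M. card {w \<in> C. linked E m w})"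
    using card_UN_le[OF finM] by simp
  also have "\<dots> \<le> (\<Sum>m\<in>M. r)"
    using card_linked M_sub leaders_C by (intro sum_mono) blast
  finally show ?thesis by simp
qed

end

section \<open>Polynomial-time functions on encodable types\<close>

text \<open>Programs see only trees; injectivity lets the equality test on trees decide equality of
  values. The instances below reproduce the prescribed format of encoded hypergraphs.\<close>

class encodable =
  fixes enc :: "'a \<Rightarrow> tree"
  assumes enc_inject: "enc x = enc y \<Longrightarrow> x = y"

lemma enc_eq_iff: "enc x = enc y \<longleftrightarrow> x = y"
  using enc_inject by blast

instantiation bool :: encodable
begin
definition enc_bool :: "bool \<Rightarrow> tree" where "enc_bool = tree_of_bool"
instance by standard (auto simp: enc_bool_def tree_of_bool_def split: if_splits)
end

lemma enc_nat_inject: "enc_nat m = enc_nat n \<Longrightarrow> m = n"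
proof (induction m arbitrary: n rule: less_induct)
  case (less m)
  show ?case
  proof (cases "m = 0 \<or> n = 0")
    case True
    then show ?thesis
      using less.prems by (auto simp: enc_nat.simps[of m] enc_nat.simps[of n] split: if_splits)
  next
    case False
    then have "odd m = odd n" "enc_nat (m div 2) = enc_nat (n div 2)"
      using less.prems by (auto simp: enc_nat.simps[of m] enc_nat.simps[of n] tree_of_bool_def split: if_splits)
    moreover from this(2) have "m div 2 = n div 2"
      using less.IH[of "m div 2" "n div 2"] False by simp
    ultimately show ?thesis by (metis div_mult_mod_eq odd_iff_mod_2_eq_one parity_cases)
  qed
qed

instantiation nat :: encodable
begin
definition enc_nat_inst: "enc = enc_nat"
instance by standard (simp add: enc_nat_inst enc_nat_inject)
end

instantiation list :: (encodable) encodable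
begin
definition enc_list_inst: "enc = enc_list enc"
instance
proof
  fix xs ys :: "'a list"
  show "enc xs = enc ys \<Longrightarrow> xs = ys"
    unfolding enc_list_inst
  proof (induction xs arbitrary: ys)
    case Nil
    then show ?case by (cases ys) auto
  next
    case (Cons x xs)
    then show ?case by (cases ys) (auto dest: enc_inject)
  qed
qed
end

instantiation prod :: (encodable, encodable) encodable
begin
definition enc_prod_inst: "enc p = Node (enc (fst p)) (enc (snd p))"
instance by standard (auto simp: enc_prod_inst enc_eq_iff prod_eq_iff)
end

lemma enc_Pair [simp]: "enc (a, b) = Node (enc a) (enc b)"
  by (simp add: enc_prod_inst)

lemma enc_Nil [simp]: "enc [] = Leaf"
  and enc_Cons [simp]: "enc (a # l) = Node (enc a) (enc l)"
  by (simp_all add: enc_list_inst)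

lemma enc_True_neq [simp]: "enc b \<noteq> Leaf \<longleftrightarrow> b" "enc b = Leaf \<longleftrightarrow> \<not> b" for b :: bool
  by (simp_all add: enc_bool_def tree_of_bool_def)

section \<open>Sizes of encodings, polynomial bounds and time-bounded runs\<close>

lemma size_enc_append [simp]: "size (enc (xs @ ys)) = size (enc xs) + size (enc ys)"
  by (induction xs) auto

lemma size_enc_member: "x \<in> set xs \<Longrightarrow> size (enc x) \<le> size (enc xs)"
  by (induction xs) auto

lemma length_le_size_enc: "length xs \<le> size (enc xs)"
  by (induction xs) auto

text \<open>The base is at least 2, so constants, sums and products are absorbed by a larger
  exponent.\<close>

definition poly_bounded :: "('a::encodable \<Rightarrow> nat) \<Rightarrow> bool" where
  "poly_bounded g \<longleftrightarrow> (\<exists>d. \<forall>x. g x \<le> (size (enc x) + 2) ^ d)"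

lemma poly_bounded_mono: "poly_bounded h \<Longrightarrow> (\<And>x. g x \<le> h x) \<Longrightarrow> poly_bounded g"
  unfolding poly_bounded_def by (meson order_trans)

lemma poly_bounded_mult:
  assumes "poly_bounded g" "poly_bounded h"
  shows "poly_bounded (\<lambda>x. g x * h x)"
proof -
  obtain c d where "\<And>x. g x \<le> (size (enc x) + 2) ^ c" "\<And>x. h x \<le> (size (enc x) + 2) ^ d"
    using assms unfolding poly_bounded_def by blast
  then have "g x * h x \<le> (size (enc x) + 2) ^ (c + d)" for x
    by (simp add: power_add mult_le_mono)
  then show ?thesis unfolding poly_bounded_def by blast
qed

lemma poly_bounded_const: "poly_bounded (\<lambda>x. n)"
proof -
  have "n \<le> (size (enc x) + 2) ^ n" for x :: 'a
    using less_exp[of n] power_mono[of 2 "size (enc x) + 2" n] by linarith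
  then show ?thesis unfolding poly_bounded_def by blast
qed

lemma poly_bounded_add:
  assumes "poly_bounded g" "poly_bounded h"
  shows "poly_bounded (\<lambda>x. g x + h x)"
proof -
  obtain c d where cd: "\<And>x. g x \<le> (size (enc x) + 2) ^ c" "\<And>x. h x \<le> (size (enc x) + 2) ^ d"
    using assms unfolding poly_bounded_def by blast
  have "g x + h x \<le> (size (enc x) + 2) ^ Suc (c + d)" for x
  proof -
    let ?b = "size (enc x) + 2"
    have "?b ^ c \<le> ?b ^ (c + d)" "?b ^ d \<le> ?b ^ (c + d)" by (simp_all add: power_increasing)
    then have "g x + h x \<le> 2 * ?b ^ (c + d)" using cd[of x] by linarith
    also have "\<dots> \<le> ?b * ?b ^ (c + d)" by simp
    finally show ?thesis by simp
  qed
  then show ?thesis unfolding poly_bounded_def by blast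
qed

lemma poly_bounded_Suc: "poly_bounded g \<Longrightarrow> poly_bounded (\<lambda>x. Suc (g x))"
  using poly_bounded_add[OF _ poly_bounded_const[of 1]] by simp

lemma poly_bounded_size: "poly_bounded (\<lambda>x. size (enc x))"
  unfolding poly_bounded_def by (intro exI[of _ 1]) auto

lemma poly_bounded_power: "poly_bounded g \<Longrightarrow> poly_bounded (\<lambda>x. g x ^ n)"
  by (induction n) (auto intro: poly_bounded_const poly_bounded_mult)

lemma poly_bounded_comp:
  assumes "poly_bounded g" "poly_bounded (\<lambda>x. size (enc (f x)))"
  shows "poly_bounded (\<lambda>x. g (f x))"
proof -
  obtain d where d: "\<And>y. g y \<le> (size (enc y) + 2) ^ d"
    using assms(1) unfolding poly_bounded_def by blast
  have "poly_bounded (\<lambda>x. (size (enc (f x)) + 2) ^ d)"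
    by (intro poly_bounded_power poly_bounded_add assms(2) poly_bounded_const)
  then show ?thesis using d by (rule poly_bounded_mono)
qed

lemmas poly_bounded_intros =
  poly_bounded_add poly_bounded_mult poly_bounded_const poly_bounded_Suc poly_bounded_size
  poly_bounded_power

text \<open>An upper bound in place of the exact time, so that every rule may round up.\<close>

definition runs :: "com \<Rightarrow> store \<Rightarrow> nat \<Rightarrow> store \<Rightarrow> bool" where
  "runs c s b s' \<longleftrightarrow> (\<exists>t\<le>b. exec c s t s')"

lemma runs_Assign: "eval_expr e s = y \<Longrightarrow> Suc (cost_expr e s) \<le> b \<Longrightarrow> runs (Assign v e) s b (s(v := y))"
  unfolding runs_def using exec.Assign by blast

lemma runs_Seq: "runs c1 s b1 s' \<Longrightarrow> runs c2 s' b2 s'' \<Longrightarrow> Suc (b1 + b2) \<le> b \<Longrightarrow> runs (Seq c1 c2) s b s''"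
  unfolding runs_def by (meson Suc_le_mono add_mono exec.Seq order_trans)

lemma runs_mono: "runs c s b s' \<Longrightarrow> b \<le> b' \<Longrightarrow> runs c s b' s'"
  unfolding runs_def by (meson order_trans)

lemma runs_IfTrue: "eval_expr e s \<noteq> Leaf \<Longrightarrow> runs c1 s b s' \<Longrightarrow> Suc (cost_expr e s + b) \<le> b' \<Longrightarrow>
    runs (If e c1 c2) s b' s'"
  unfolding runs_def by (meson Suc_le_mono add_left_mono exec.IfTrue order_trans)

lemma runs_IfFalse: "eval_expr e s = Leaf \<Longrightarrow> runs c2 s b s' \<Longrightarrow> Suc (cost_expr e s + b) \<le> b' \<Longrightarrow>
    runs (If e c1 c2) s b' s'"
  unfolding runs_def by (meson Suc_le_mono add_left_mono exec.IfFalse order_trans)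

lemma runs_WhileFalse: "eval_expr e s = Leaf \<Longrightarrow> Suc (cost_expr e s) \<le> b \<Longrightarrow> runs (While e c) s b s"
  unfolding runs_def using exec.WhileFalse by blast

lemma runs_WhileTrue:
  assumes "eval_expr e s \<noteq> Leaf" "runs c s b1 s'" "runs (While e c) s' b2 s''"
    "Suc (cost_expr e s + b1 + b2) \<le> b"
  shows "runs (While e c) s b s''"
proof -
  obtain t1 t2 where t: "t1 \<le> b1" "t2 \<le> b2" "exec c s t1 s'" "exec (While e c) s' t2 s''"
    using assms(2,3) unfolding runs_def by blast
  have "exec (While e c) s (Suc (cost_expr e s + t1 + t2)) s''"
    using exec.WhileTrue assms(1) t by blast
  moreover have "Suc (cost_expr e s + t1 + t2) \<le> b" using t assms(4) by linarith
  ultimately show ?thesis unfolding runs_def by blast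
qed

primrec assigned :: "com \<Rightarrow> nat set" where
  "assigned Skip = {}"
| "assigned (Assign v e) = {v}"
| "assigned (Seq c1 c2) = assigned c1 \<union> assigned c2"
| "assigned (If e c1 c2) = assigned c1 \<union> assigned c2"
| "assigned (While e c) = assigned c"

lemma finite_assigned: "finite (assigned c)"
  by (induction c) auto

lemma exec_frame: "exec c s t s' \<Longrightarrow> v \<notin> assigned c \<Longrightarrow> s' v = s v"
  by (induction rule: exec.induct) auto

lemma runs_frame: "runs c s b s' \<Longrightarrow> v \<notin> assigned c \<Longrightarrow> s' v = s v"
  unfolding runs_def using exec_frame by blast

text \<open>All variables from \<open>m\<close> on survive the given programs and can hold data
  across their runs. The input and output variable 0 lies below \<open>m\<close>.\<close>

lemma obtain_fresh:
  obtains m where "0 < m" "\<forall>c\<in>set cs. \<forall>v\<ge>m. v \<notin> assigned c"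
proof -
  have "finite (insert 0 (\<Union>c\<in>set cs. assigned c))" using finite_assigned by auto
  then obtain m where "\<forall>v \<in> insert 0 (\<Union>c\<in>set cs. assigned c). v < m"
    using finite_nat_set_iff_bounded by auto
  then show thesis using that[of m] by (metis UN_I insertCI leD)
qed

lemma size_eval_less: "size (eval_expr e s) < cost_expr e s"
  by (cases e) auto

text \<open>An assignment costs more than the size of the stored value. So polynomial time bounds
  the size of the output, which composition relies on.\<close>

lemma exec_size: "exec c s t s' \<Longrightarrow> size (s' v) \<le> size (s v) + t"
proof (induction rule: exec.induct)
  case (Assign w e s)
  then show ?case using size_eval_less[of e s] by auto
qed auto

text \<open>The store is arbitrary except for variable 0, so programs can follow each other without
  erasing what earlier ones left behind.\<close>

definition poly_time :: "('a::encodable \<Rightarrow> 'b::encodable) \<Rightarrow> bool" where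
  "poly_time f \<longleftrightarrow> (\<exists>c b. poly_bounded b \<and>
     (\<forall>x s. s 0 = enc x \<longrightarrow> (\<exists>s'. runs c s (b x) s' \<and> s' 0 = enc (f x))))"

lemma poly_timeE:
  assumes "poly_time f"
  obtains c b where "poly_bounded b"
    "\<forall>x s. s 0 = enc x \<longrightarrow> (\<exists>s'. runs c s (b x) s' \<and> s' 0 = enc (f x))"
  using assms unfolding poly_time_def by (elim exE conjE)

lemma poly_timeI:
  assumes "poly_bounded b"
    "\<And>x s. s 0 = enc x \<Longrightarrow> \<exists>s'. runs c s (b x) s' \<and> s' 0 = enc (f x)"
  shows "poly_time f"
  using assms unfolding poly_time_def by blast

lemma poly_time_size:
  assumes "poly_time f"
  shows "poly_bounded (\<lambda>x. size (enc (f x)))"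
proof -
  obtain c b where b: "poly_bounded b"
    and c: "\<forall>x s. s 0 = enc x \<longrightarrow> (\<exists>s'. runs c s (b x) s' \<and> s' 0 = enc (f x))"
    using assms by (rule poly_timeE)
  have "size (enc (f x)) \<le> size (enc x) + b x" for x
  proof -
    obtain s' where "runs c (\<lambda>_. enc x) (b x) s'" "s' 0 = enc (f x)"
      using c[rule_format, of "\<lambda>_. enc x" x] by auto
    then obtain t where "t \<le> b x" "exec c (\<lambda>_. enc x) t s'" unfolding runs_def by blast
    then show ?thesis using exec_size[of c "\<lambda>_. enc x" t s' 0] \<open>s' 0 = enc (f x)\<close> by simp
  qed
  note le = this
  have "poly_bounded (\<lambda>x. size (enc x) + b x)" by (intro poly_bounded_intros b)
  then show ?thesis using le by (rule poly_bounded_mono)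
qed

lemma poly_time_expr:
  fixes f :: "'a::encodable \<Rightarrow> 'b::encodable"
  assumes "\<And>x s. s 0 = enc x \<Longrightarrow> eval_expr e s = enc (f x) \<and> cost_expr e s \<le> b x" "poly_bounded b"
  shows "poly_time f"
proof (rule poly_timeI)
  show "poly_bounded (\<lambda>x. Suc (b x))" by (intro poly_bounded_intros assms(2))
  fix x :: 'a and s :: store
  assume s: "s 0 = enc x"
  have "runs (Assign 0 e) s (Suc (b x)) (s(0 := enc (f x)))"
    using assms(1)[of s x, OF s] by (intro runs_Assign) auto
  then show "\<exists>s'. runs (Assign 0 e) s (Suc (b x)) s' \<and> s' 0 = enc (f x)" by fastforce
qed

text \<open>Functions with the same output trees have the same programs, even if their result types
  differ. This identifies list cells with pairs and numbers with their digit lists.\<close>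

lemma poly_time_recode:
  assumes "poly_time f" "\<And>x. enc (g x) = enc (f x)"
  shows "poly_time g"
  using assms unfolding poly_time_def by simp

section \<open>Closure under composition, pairing, case distinction and folds\<close>

lemma poly_time_id: "poly_time (\<lambda>x. x)"
  by (rule poly_time_expr[where e = "EVar 0" and b = "\<lambda>x. Suc (size (enc x))"])
    (auto intro: poly_bounded_intros)

primrec expr_of :: "tree \<Rightarrow> expr" where
  "expr_of Leaf = ELeaf"
| "expr_of (Node a b) = ENode (expr_of a) (expr_of b)"

lemma eval_expr_of: "eval_expr (expr_of t) s = t"
  by (induction t) auto

lemma cost_expr_of: "cost_expr (expr_of t) s = cost_expr (expr_of t) s'"
  by (induction t) (auto simp: eval_expr_of)

lemma poly_time_const: "poly_time (\<lambda>x. a)"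
proof (rule poly_time_expr)
  show "eval_expr (expr_of (enc a)) s = enc a \<and>
      cost_expr (expr_of (enc a)) s \<le> cost_expr (expr_of (enc a)) (\<lambda>_. Leaf)" for s
    using cost_expr_of[of "enc a" s "\<lambda>_. Leaf"] by (simp add: eval_expr_of)
qed (rule poly_bounded_const)

lemma poly_time_comp:
  fixes f :: "'a::encodable \<Rightarrow> 'b::encodable" and g :: "'b \<Rightarrow> 'c::encodable"
  assumes "poly_time g" "poly_time f"
  shows "poly_time (\<lambda>x. g (f x))"
proof -
  obtain cg bg where g: "poly_bounded bg"
    "\<forall>x s. s 0 = enc x \<longrightarrow> (\<exists>s'. runs cg s (bg x) s' \<and> s' 0 = enc (g x))"
    using assms(1) by (rule poly_timeE)
  obtain cf bf where f: "poly_bounded bf"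
    "\<forall>x s. s 0 = enc x \<longrightarrow> (\<exists>s'. runs cf s (bf x) s' \<and> s' 0 = enc (f x))"
    using assms(2) by (rule poly_timeE)
  show ?thesis
  proof (rule poly_timeI)
    show "poly_bounded (\<lambda>x. Suc (bf x + bg (f x)))"
      by (intro poly_bounded_intros f(1) poly_bounded_comp[OF g(1)] poly_time_size assms(2))
    fix x :: 'a and s :: store
    assume "s 0 = enc x"
    then obtain s' where "runs cf s (bf x) s'" "s' 0 = enc (f x)" using f(2) by blast
    moreover from this obtain s'' where "runs cg s' (bg (f x)) s''" "s'' 0 = enc (g (f x))"
      using g(2) by blast
    ultimately show "\<exists>s'. runs (Seq cf cg) s (Suc (bf x + bg (f x))) s' \<and> s' 0 = enc (g (f x))"
      using runs_Seq by blast
  qed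
qed

lemma poly_time_Pair:
  fixes f :: "'a::encodable \<Rightarrow> 'b::encodable" and g :: "'a \<Rightarrow> 'c::encodable"
  assumes "poly_time f" "poly_time g"
  shows "poly_time (\<lambda>x. (f x, g x))"
proof -
  obtain cf bf where f: "poly_bounded bf"
    "\<forall>x s. s 0 = enc x \<longrightarrow> (\<exists>s'. runs cf s (bf x) s' \<and> s' 0 = enc (f x))"
    using assms(1) by (rule poly_timeE)
  obtain cg bg where g: "poly_bounded bg"
    "\<forall>x s. s 0 = enc x \<longrightarrow> (\<exists>s'. runs cg s (bg x) s' \<and> s' 0 = enc (g x))"
    using assms(2) by (rule poly_timeE)
  obtain m where m: "0 < m" "\<forall>c\<in>set [cf, cg]. \<forall>v\<ge>m. v \<notin> assigned c"
    using obtain_fresh .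
  define c where "c = Seq (Assign m (EVar 0)) (Seq cf (Seq (Assign (Suc m) (EVar 0))
    (Seq (Assign 0 (EVar m)) (Seq cg (Assign 0 (ENode (EVar (Suc m)) (EVar 0)))))))"
  define b where "b x = 30 + 4 * size (enc x) + 4 * size (enc (f x)) + 4 * size (enc (g x)) + bf x + bg x" for x
  show ?thesis
  proof (rule poly_timeI)
    show "poly_bounded b"
      unfolding b_def by (intro poly_bounded_intros f(1) g(1) poly_time_size assms)
    fix x :: 'a and s :: store
    assume s: "s 0 = enc x"
    define s1 where "s1 = s(m := enc x)"
    have s1: "s1 0 = enc x" using s m(1) by (simp add: s1_def)
    obtain s2 where s2: "runs cf s1 (bf x) s2" "s2 0 = enc (f x)" using f(2) s1 by blast
    have s2m: "s2 m = enc x" using runs_frame[OF s2(1), of m] m by (simp add: s1_def)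
    define s3 where "s3 = s2(Suc m := enc (f x))"
    define s4 where "s4 = s3(0 := enc x)"
    have s4: "s4 0 = enc x" by (simp add: s4_def)
    obtain s5 where s5: "runs cg s4 (bg x) s5" "s5 0 = enc (g x)" using g(2) s4 by blast
    have s5m: "s5 (Suc m) = enc (f x)"
      using runs_frame[OF s5(1), of "Suc m"] m by (simp add: s4_def s3_def)
    have 1: "runs (Assign m (EVar 0)) s (size (enc x) + 2) s1"
      unfolding s1_def by (rule runs_Assign) (use s in auto)
    have 3: "runs (Assign (Suc m) (EVar 0)) s2 (size (enc (f x)) + 2) s3"
      unfolding s3_def by (rule runs_Assign) (use s2 in auto)
    have 4: "runs (Assign 0 (EVar m)) s3 (size (enc x) + 2) s4"
      unfolding s4_def by (rule runs_Assign) (use s2m s3_def in auto)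
    have 6: "runs (Assign 0 (ENode (EVar (Suc m)) (EVar 0))) s5
        (2 * size (enc (f x)) + 2 * size (enc (g x)) + 5) (s5(0 := enc (f x, g x)))"
      by (rule runs_Assign) (use s5 s5m in auto)
    have "runs c s (b x) (s5(0 := enc (f x, g x)))"
      unfolding c_def b_def
      by (rule runs_Seq[OF 1 runs_Seq[OF s2(1) runs_Seq[OF 3 runs_Seq[OF 4 runs_Seq[OF s5(1) 6 order_refl]
            order_refl] order_refl] order_refl]]) simp
    then show "\<exists>s'. runs c s (b x) s' \<and> s' 0 = enc (f x, g x)" by (metis fun_upd_same)
  qed
qed

lemma poly_time_If:
  fixes f :: "'a::encodable \<Rightarrow> 'b::encodable" and g :: "'a \<Rightarrow> 'b"
  assumes "poly_time P" "poly_time f" "poly_time g"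
  shows "poly_time (\<lambda>x. if P x then f x else g x)"
proof -
  obtain cp bp where p: "poly_bounded bp"
    "\<forall>x s. s 0 = enc x \<longrightarrow> (\<exists>s'. runs cp s (bp x) s' \<and> s' 0 = enc (P x))"
    using assms(1) by (rule poly_timeE)
  obtain cf bf where f: "poly_bounded bf"
    "\<forall>x s. s 0 = enc x \<longrightarrow> (\<exists>s'. runs cf s (bf x) s' \<and> s' 0 = enc (f x))"
    using assms(2) by (rule poly_timeE)
  obtain cg bg where g: "poly_bounded bg"
    "\<forall>x s. s 0 = enc x \<longrightarrow> (\<exists>s'. runs cg s (bg x) s' \<and> s' 0 = enc (g x))"
    using assms(3) by (rule poly_timeE)
  obtain m where m: "0 < m" "\<forall>c\<in>set [cp, cf, cg]. \<forall>v\<ge>m. v \<notin> assigned c"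
    using obtain_fresh .
  define rest where "rest = If (EVar 0) (Seq (Assign 0 (EVar m)) cf) (Seq (Assign 0 (EVar m)) cg)"
  define c where "c = Seq (Assign m (EVar 0)) (Seq cp rest)"
  define b where "b x = 30 + 4 * size (enc x) + size (enc (P x)) + bp x + bf x + bg x" for x
  show ?thesis
  proof (rule poly_timeI)
    show "poly_bounded b"
      unfolding b_def by (intro poly_bounded_intros p(1) f(1) g(1) poly_time_size assms)
    fix x :: 'a and s :: store
    assume s: "s 0 = enc x"
    define s1 where "s1 = s(m := enc x)"
    have s1: "s1 0 = enc x" using s m(1) by (simp add: s1_def)
    obtain s2 where s2: "runs cp s1 (bp x) s2" "s2 0 = enc (P x)" using p(2) s1 by blast
    have s2m: "s2 m = enc x" using runs_frame[OF s2(1), of m] m by (simp add: s1_def)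
    define s3 where "s3 = s2(0 := enc x)"
    have s3: "s3 0 = enc x" by (simp add: s3_def)
    have 1: "runs (Assign m (EVar 0)) s (size (enc x) + 2) s1"
      unfolding s1_def by (rule runs_Assign) (use s in auto)
    have 3: "runs (Assign 0 (EVar m)) s2 (size (enc x) + 2) s3"
      unfolding s3_def by (rule runs_Assign) (use s2m in auto)
    have "\<exists>s'. runs rest s2 (10 + size (enc x) + size (enc (P x)) + bf x + bg x) s' \<and>
        s' 0 = enc (if P x then f x else g x)"
    proof (cases "P x")
      case True
      obtain s4 where s4: "runs cf s3 (bf x) s4" "s4 0 = enc (f x)" using f(2) s3 by blast
      have "runs rest s2 (10 + size (enc x) + size (enc (P x)) + bf x + bg x) s4"
        unfolding rest_def
        by (rule runs_IfTrue[OF _ runs_Seq[OF 3 s4(1) order_refl]]) (use s2 True in auto)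
      then show ?thesis using s4 True by auto
    next
      case False
      obtain s4 where s4: "runs cg s3 (bg x) s4" "s4 0 = enc (g x)" using g(2) s3 by blast
      have "runs rest s2 (10 + size (enc x) + size (enc (P x)) + bf x + bg x) s4"
        unfolding rest_def
        by (rule runs_IfFalse[OF _ runs_Seq[OF 3 s4(1) order_refl]]) (use s2 False in auto)
      then show ?thesis using s4 False by auto
    qed
    then obtain s' where s': "runs rest s2 (10 + size (enc x) + size (enc (P x)) + bf x + bg x) s'"
      "s' 0 = enc (if P x then f x else g x)" by blast
    have "runs c s (b x) s'"
      unfolding c_def b_def by (rule runs_Seq[OF 1 runs_Seq[OF s2(1) s'(1) order_refl]]) simp
    then show "\<exists>s'. runs c s (b x) s' \<and> s' 0 = enc (if P x then f x else g x)" using s'(2) by blast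
  qed
qed

text \<open>Variable \<open>m\<close> holds the fixed argument, the next one the remaining list and
  the one after it the state. A uniform bound S on all intermediate states bounds every round by the
  same cost.\<close>

lemma runs_fold:
  fixes g :: "'b::encodable \<Rightarrow> 'c::encodable \<Rightarrow> 'c"
  assumes m: "0 < m" "\<And>v. m \<le> v \<Longrightarrow> v \<notin> assigned cg"
    and cg: "\<And>b st s. s 0 = Node X (Node (enc b) (enc st)) \<Longrightarrow>
        \<exists>s'. runs cg s (B b st) s' \<and> s' 0 = enc (g b st)"
    and B: "\<And>b st. b \<in> set bs \<Longrightarrow> size (enc st) \<le> S \<Longrightarrow> B b st \<le> K"
    and loop: "loop = While (EVar (Suc m)) (Seq (Assign 0 (ENode (EVar m)
        (ENode (ELeft (EVar (Suc m))) (EVar (Suc (Suc m)))))) (Seq cg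
        (Seq (Assign (Suc (Suc m)) (EVar 0)) (Assign (Suc m) (ERight (EVar (Suc m)))))))"
    and l: "size (enc bs) \<le> l"
    and s: "s m = X" "s (Suc m) = enc bs" "s (Suc (Suc m)) = enc st"
    and S: "\<And>p q. bs = p @ q \<Longrightarrow> size (enc (foldl (\<lambda>st b. g b st) st p)) \<le> S"
  shows "\<exists>s'. runs loop s ((length bs + 1) * (K + 40 + 10 * (size X + l + S))) s' \<and>
     s' (Suc (Suc m)) = enc (foldl (\<lambda>st b. g b st) st bs)"
  using B l s S
proof (induction bs arbitrary: s st)
  case Nil
  have "runs loop s ((length [] + 1) * (K + 40 + 10 * (size X + l + S))) s"
    unfolding loop by (rule runs_WhileFalse) (use Nil in auto)
  then show ?case using Nil by auto
next
  case (Cons b bs)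
  let ?K = "K + 40 + 10 * (size X + l + S)"
  have S0: "size (enc st) \<le> S" using Cons.prems(6)[of "[]"] by simp
  have S1: "size (enc (g b st)) \<le> S" using Cons.prems(6)[of "[b]"] by simp
  have lb: "size (enc b) + size (enc bs) < l" using Cons.prems(2) by simp
  define s1 where "s1 = s(0 := Node X (Node (enc b) (enc st)))"
  have 1: "runs (Assign 0 (ENode (EVar m) (ENode (ELeft (EVar (Suc m))) (EVar (Suc (Suc m))))))
      s (15 + 2 * size X + 4 * l + 3 * S) s1"
    unfolding s1_def by (rule runs_Assign) (use Cons.prems S0 lb in auto)
  obtain s2 where s2: "runs cg s1 (B b st) s2" "s2 0 = enc (g b st)"
    using cg[of s1] by (auto simp: s1_def)
  have B: "B b st \<le> K" using Cons.prems(1) S0 by simp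
  have fr: "s2 v = s v" if "m \<le> v" for v
    using runs_frame[OF s2(1) m(2)[OF that]] that m(1) by (simp add: s1_def)
  define s3 where "s3 = s2(Suc (Suc m) := enc (g b st))"
  have 3: "runs (Assign (Suc (Suc m)) (EVar 0)) s2 (2 + S) s3"
    unfolding s3_def by (rule runs_Assign) (use s2 S1 in auto)
  define s4 where "s4 = s3(Suc m := enc bs)"
  have 4: "runs (Assign (Suc m) (ERight (EVar (Suc m)))) s3 (3 + 2 * l) s4"
    unfolding s4_def by (rule runs_Assign) (use fr[of "Suc m"] Cons.prems lb in \<open>auto simp: s3_def\<close>)
  obtain s' where s': "runs loop s4 ((length bs + 1) * ?K) s'"
    "s' (Suc (Suc m)) = enc (foldl (\<lambda>st b. g b st) (g b st) bs)"
  proof -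
    have "\<exists>s'. runs loop s4 ((length bs + 1) * ?K) s' \<and>
      s' (Suc (Suc m)) = enc (foldl (\<lambda>st b. g b st) (g b st) bs)"
    proof (rule Cons.IH)
      show "s4 m = X" using fr[of m] Cons.prems(3) by (simp add: s4_def s3_def)
      show "s4 (Suc m) = enc bs" "s4 (Suc (Suc m)) = enc (g b st)" by (simp_all add: s4_def s3_def)
      show "size (enc bs) \<le> l" using lb by simp
      show "B b' st' \<le> K" if "b' \<in> set bs" "size (enc st') \<le> S" for b' st'
        using Cons.prems(1) that by simp
      show "size (enc (foldl (\<lambda>st b. g b st) (g b st) p)) \<le> S" if "bs = p @ q" for p q
        using Cons.prems(6)[of "b # p" q] that by simp
    qed
    then show thesis using that by blast
  qed
  have "runs loop s ((length (b # bs) + 1) * ?K) s'"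
    unfolding loop
    by (rule runs_WhileTrue[OF _ runs_Seq[OF 1 runs_Seq[OF s2(1) runs_Seq[OF 3 4 order_refl]
        order_refl] order_refl] s'(1)[unfolded loop]])
      (use Cons.prems(2,4) B in auto)
  then show ?case using s'(2) by auto
qed

text \<open>The bound S on the intermediate states has to be supplied, since a polynomial-time step
  that doubles its state would make the fold exponential.\<close>

lemma poly_time_fold:
  fixes g :: "'a::encodable \<Rightarrow> 'b::encodable \<Rightarrow> 'c::encodable \<Rightarrow> 'c"
  assumes L: "poly_time L" and i: "poly_time i"
    and g: "poly_time (\<lambda>y. g (fst y) (fst (snd y)) (snd (snd y)))"
    and S: "poly_bounded S"
      "\<And>x p q. L x = p @ q \<Longrightarrow> size (enc (foldl (\<lambda>st b. g x b st) (i x) p)) \<le> S x"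
  shows "poly_time (\<lambda>x. foldl (\<lambda>st b. g x b st) (i x) (L x))"
proof -
  obtain cl bl where l: "poly_bounded bl"
    "\<forall>x s. s 0 = enc x \<longrightarrow> (\<exists>s'. runs cl s (bl x) s' \<and> s' 0 = enc (L x))"
    using L by (rule poly_timeE)
  obtain ci bi where ci: "poly_bounded bi"
    "\<forall>x s. s 0 = enc x \<longrightarrow> (\<exists>s'. runs ci s (bi x) s' \<and> s' 0 = enc (i x))"
    using i by (rule poly_timeE)
  obtain cg bg where cg: "poly_bounded bg"
    "\<forall>y s. s 0 = enc y \<longrightarrow> (\<exists>s'. runs cg s (bg y) s' \<and>
       s' 0 = enc (g (fst y) (fst (snd y)) (snd (snd y))))"
    using g by (rule poly_timeE)
  obtain d where d: "\<And>y. bg y \<le> (size (enc y) + 2) ^ d"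
    using cg(1) unfolding poly_bounded_def by blast
  obtain m where m: "0 < m" "\<forall>c\<in>set [cl, ci, cg]. \<forall>v\<ge>m. v \<notin> assigned c"
    using obtain_fresh .
  define loop where "loop = While (EVar (Suc m)) (Seq (Assign 0 (ENode (EVar m)
        (ENode (ELeft (EVar (Suc m))) (EVar (Suc (Suc m)))))) (Seq cg
        (Seq (Assign (Suc (Suc m)) (EVar 0)) (Assign (Suc m) (ERight (EVar (Suc m)))))))"
  define c where "c = Seq (Assign m (EVar 0)) (Seq cl (Seq (Assign (Suc m) (EVar 0))
    (Seq (Assign 0 (EVar m)) (Seq ci (Seq (Assign (Suc (Suc m)) (EVar 0))
    (Seq loop (Assign 0 (EVar (Suc (Suc m))))))))))"
  define K where "K x = (size (enc x) + size (enc (L x)) + S x + 4) ^ d" for x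
  define W where "W x = (size (enc (L x)) + 1) * (K x + 40 + 10 * (size (enc x) + size (enc (L x)) + S x))" for x
  define b where "b x = 40 + 4 * size (enc x) + 4 * size (enc (L x)) + 4 * S x + bl x + bi x + W x" for x
  show ?thesis
  proof (rule poly_timeI)
    show "poly_bounded b"
      unfolding b_def W_def K_def
      by (intro poly_bounded_intros l(1) ci(1) S(1) poly_time_size L)
    fix x :: 'a and s :: store
    assume s: "s 0 = enc x"
    define s1 where "s1 = s(m := enc x)"
    have s1: "s1 0 = enc x" using s m(1) by (simp add: s1_def)
    obtain s2 where s2: "runs cl s1 (bl x) s2" "s2 0 = enc (L x)" using l(2) s1 by blast
    have s2m: "s2 m = enc x" using runs_frame[OF s2(1), of m] m by (simp add: s1_def)
    define s3 where "s3 = s2(Suc m := enc (L x))"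
    define s4 where "s4 = s3(0 := enc x)"
    have s4: "s4 0 = enc x" by (simp add: s4_def)
    obtain s5 where s5: "runs ci s4 (bi x) s5" "s5 0 = enc (i x)" using ci(2) s4 by blast
    have s5m: "s5 m = enc x" "s5 (Suc m) = enc (L x)"
      using runs_frame[OF s5(1), of "Suc m"] runs_frame[OF s5(1), of m] m s2m
      by (simp_all add: s4_def s3_def)
    define s6 where "s6 = s5(Suc (Suc m) := enc (i x))"
    have S0: "size (enc (i x)) \<le> S x" using S(2)[of x "[]"] by simp
    have "\<exists>s'. runs loop s6 ((length (L x) + 1) *
        (K x + 40 + 10 * (size (enc x) + size (enc (L x)) + S x))) s' \<and>
        s' (Suc (Suc m)) = enc (foldl (\<lambda>st b. g x b st) (i x) (L x))"
    proof (rule runs_fold[where cg = cg and B = "\<lambda>b st. bg (x, b, st)"])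
      fix b :: 'b and st :: 'c and s :: store
      assume "s 0 = Node (enc x) (Node (enc b) (enc st))"
      then show "\<exists>s'. runs cg s (bg (x, b, st)) s' \<and> s' 0 = enc (g x b st)"
        using cg(2)[rule_format, of s "(x, b, st)"] by simp
    next
      fix b :: 'b and st :: 'c
      assume "b \<in> set (L x)" "size (enc st) \<le> S x"
      then have "size (enc (x, b, st)) + 2 \<le> size (enc x) + size (enc (L x)) + S x + 4"
        using size_enc_member[of b "L x"] by simp
      then have "(size (enc (x, b, st)) + 2) ^ d \<le> K x"
        unfolding K_def by (intro power_mono) simp_all
      then show "bg (x, b, st) \<le> K x" using d[of "(x, b, st)"] by linarith
    qed (use m s5m S(2) in \<open>auto simp: loop_def s6_def\<close>)
    then obtain s7 where s7: "runs loop s6 ((length (L x) + 1) *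
        (K x + 40 + 10 * (size (enc x) + size (enc (L x)) + S x))) s7"
      "s7 (Suc (Suc m)) = enc (foldl (\<lambda>st b. g x b st) (i x) (L x))" by blast
    have 7: "runs loop s6 (W x) s7"
      by (rule runs_mono[OF s7(1)]) (use length_le_size_enc[of "L x"] in \<open>simp add: W_def\<close>)
    have Sf: "size (enc (foldl (\<lambda>st b. g x b st) (i x) (L x))) \<le> S x" using S(2)[of x "L x" "[]"] by simp
    have 1: "runs (Assign m (EVar 0)) s (size (enc x) + 2) s1"
      unfolding s1_def by (rule runs_Assign) (use s in auto)
    have 3: "runs (Assign (Suc m) (EVar 0)) s2 (size (enc (L x)) + 2) s3"
      unfolding s3_def by (rule runs_Assign) (use s2 in auto)
    have 4: "runs (Assign 0 (EVar m)) s3 (size (enc x) + 2) s4"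
      unfolding s4_def by (rule runs_Assign) (use s2m s3_def in auto)
    have 6: "runs (Assign (Suc (Suc m)) (EVar 0)) s5 (S x + 2) s6"
      unfolding s6_def by (rule runs_Assign) (use s5 S0 in auto)
    have 8: "runs (Assign 0 (EVar (Suc (Suc m)))) s7 (S x + 2)
        (s7(0 := enc (foldl (\<lambda>st b. g x b st) (i x) (L x))))"
      by (rule runs_Assign) (use s7 Sf in auto)
    have "runs c s (b x) (s7(0 := enc (foldl (\<lambda>st b. g x b st) (i x) (L x))))"
      unfolding c_def b_def
      by (rule runs_Seq[OF 1 runs_Seq[OF s2(1) runs_Seq[OF 3 runs_Seq[OF 4 runs_Seq[OF s5(1)
            runs_Seq[OF 6 runs_Seq[OF 7 8 order_refl] order_refl] order_refl] order_refl]
            order_refl] order_refl]]) simp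
    then show "\<exists>s'. runs c s (b x) s' \<and> s' 0 = enc (foldl (\<lambda>st b. g x b st) (i x) (L x))"
      by (metis fun_upd_same)
  qed
qed

section \<open>Logical connectives and list functions\<close>

named_theorems ptime

declare poly_time_id [ptime] poly_time_const [ptime] poly_time_Pair [ptime] poly_time_If [ptime]

lemma poly_time_comp2:
  assumes "poly_time (\<lambda>y. h (fst y) (snd y))" "poly_time f" "poly_time g"
  shows "poly_time (\<lambda>x. h (f x) (g x))"
  using poly_time_comp[OF assms(1) poly_time_Pair[OF assms(2,3)]] by simp

lemma poly_time_comp3:
  assumes "poly_time (\<lambda>y. h (fst y) (fst (snd y)) (snd (snd y)))"
    "poly_time f" "poly_time g" "poly_time k"
  shows "poly_time (\<lambda>x. h (f x) (g x) (k x))"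
  using poly_time_comp[OF assms(1) poly_time_Pair[OF assms(2) poly_time_Pair[OF assms(3,4)]]] by simp

lemma poly_time_fst [ptime]:
  fixes f :: "'a::encodable \<Rightarrow> 'b::encodable \<times> 'c::encodable"
  assumes "poly_time f"
  shows "poly_time (\<lambda>x. fst (f x))"
proof (rule poly_time_comp[OF _ assms])
  show "poly_time (fst :: 'b \<times> 'c \<Rightarrow> 'b)"
    by (rule poly_time_expr[where e = "ELeft (EVar 0)" and b = "\<lambda>x. 2 + 2 * size (enc x)"]; (intro poly_bounded_intros)?;
      auto simp: enc_prod_inst)
qed

lemma poly_time_snd [ptime]:
  fixes f :: "'a::encodable \<Rightarrow> 'b::encodable \<times> 'c::encodable"
  assumes "poly_time f"
  shows "poly_time (\<lambda>x. snd (f x))"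
proof (rule poly_time_comp[OF _ assms])
  show "poly_time (snd :: 'b \<times> 'c \<Rightarrow> 'c)"
    by (rule poly_time_expr[where e = "ERight (EVar 0)" and b = "\<lambda>x. 2 + 2 * size (enc x)"]; (intro poly_bounded_intros)?;
      auto simp: enc_prod_inst)
qed

lemma poly_time_eq [ptime]:
  fixes f g :: "'a::encodable \<Rightarrow> 'b::encodable"
  assumes "poly_time f" "poly_time g"
  shows "poly_time (\<lambda>x. f x = g x)"
proof (rule poly_time_comp2[where h = "(=)", OF _ assms])
  show "poly_time (\<lambda>y :: 'b \<times> 'b. fst y = snd y)"
    by (rule poly_time_expr[where e = "EEq (ELeft (EVar 0)) (ERight (EVar 0))"
          and b = "\<lambda>x. 10 + 4 * size (enc x)"]; (intro poly_bounded_intros)?;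
      auto simp: enc_prod_inst enc_bool_def enc_eq_iff tree_of_bool_def)
qed

lemma poly_time_not [ptime]: "poly_time P \<Longrightarrow> poly_time (\<lambda>x. \<not> P x)"
  using poly_time_eq[OF _ poly_time_const[of False], of P] by simp

lemma poly_time_conj [ptime]: "poly_time P \<Longrightarrow> poly_time Q \<Longrightarrow> poly_time (\<lambda>x. P x \<and> Q x)"
  by (rule poly_time_recode[OF poly_time_If[of P Q "\<lambda>x. False"]]) (auto intro: poly_time_const)

lemma poly_time_imp [ptime]: "poly_time P \<Longrightarrow> poly_time Q \<Longrightarrow> poly_time (\<lambda>x. P x \<longrightarrow> Q x)"
  by (rule poly_time_recode[OF poly_time_If[of P Q "\<lambda>x. True"]]) (auto intro: poly_time_const)

lemma poly_time_Cons [ptime]: "poly_time f \<Longrightarrow> poly_time g \<Longrightarrow> poly_time (\<lambda>x. f x # g x)"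
  by (rule poly_time_recode[OF poly_time_Pair]) auto

lemma poly_time_tl [ptime]:
  fixes f :: "'a::encodable \<Rightarrow> 'b::encodable list"
  assumes "poly_time f"
  shows "poly_time (\<lambda>x. tl (f x))"
proof (rule poly_time_comp[OF _ assms])
  show "poly_time (tl :: 'b list \<Rightarrow> 'b list)"
  proof (rule poly_time_expr[where e = "ERight (EVar 0)" and b = "\<lambda>x. 2 + 2 * size (enc x)"])
    fix x :: "'b list" and s :: store
    assume "s 0 = enc x"
    then show "eval_expr (ERight (EVar 0)) s = enc (tl x) \<and>
        cost_expr (ERight (EVar 0)) s \<le> 2 + 2 * size (enc x)"
      by (cases x) auto
  qed (intro poly_bounded_intros)
qed

text \<open>Here \<open>n\<close> is a constant of the program, which takes the tail n
  times.\<close>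

lemma poly_time_drop: "poly_time f \<Longrightarrow> poly_time (\<lambda>x. drop n (f x))"
proof (induction n)
  case (Suc n)
  then have "poly_time (\<lambda>x. tl (drop n (f x)))" by (intro poly_time_tl)
  then show ?case by (simp add: drop_Suc tl_drop)
qed simp

text \<open>A growth per round that does not depend on the state adds up to a polynomial.\<close>

lemma poly_time_fold_additive:
  fixes g :: "'a::encodable \<Rightarrow> 'b::encodable \<Rightarrow> 'c::encodable \<Rightarrow> 'c"
  assumes L: "poly_time L" and i: "poly_time i"
    and g: "poly_time (\<lambda>y. g (fst y) (fst (snd y)) (snd (snd y)))"
    and K: "poly_bounded K"
      "\<And>x b st. b \<in> set (L x) \<Longrightarrow> size (enc (g x b st)) \<le> size (enc st) + K x"
  shows "poly_time (\<lambda>x. foldl (\<lambda>st b. g x b st) (i x) (L x))"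
proof (rule poly_time_fold[OF L i g])
  show "poly_bounded (\<lambda>x. size (enc (i x)) + size (enc (L x)) * K x)"
    by (intro poly_bounded_intros poly_time_size i L K)
  fix x p q
  assume Lx: "L x = p @ q"
  then have "size (enc (foldl (\<lambda>st b. g x b st) (i x) p)) \<le> size (enc (i x)) + length p * K x"
  proof (induction p arbitrary: q rule: rev_induct)
    case (snoc b p)
    have "b \<in> set (L x)" using snoc.prems by simp
    from K(2)[OF this, of "foldl (\<lambda>st b. g x b st) (i x) p"] snoc.IH[of "b # q"] snoc.prems
    show ?case by simp
  qed simp
  also have "length p \<le> size (enc (L x))" using Lx length_le_size_enc[of "L x"] by simp
  finally show "size (enc (foldl (\<lambda>st b. g x b st) (i x) p)) \<le>
      size (enc (i x)) + size (enc (L x)) * K x" by simp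
qed

lemma poly_time_fold_linear:
  fixes g :: "'a::encodable \<Rightarrow> 'b::encodable \<Rightarrow> 'c::encodable \<Rightarrow> 'c"
  assumes L: "poly_time L" and i: "poly_time i"
    and g: "poly_time (\<lambda>y. g (fst y) (fst (snd y)) (snd (snd y)))"
    and K: "\<And>x b st. size (enc (g x b st)) \<le> Suc (size (enc st) + size (enc b))"
  shows "poly_time (\<lambda>x. foldl (\<lambda>st b. g x b st) (i x) (L x))"
proof (rule poly_time_fold_additive[OF L i g])
  show "poly_bounded (\<lambda>x. Suc (size (enc (L x))))"
    by (intro poly_bounded_intros poly_time_size L)
  show "size (enc (g x b st)) \<le> size (enc st) + Suc (size (enc (L x)))" if "b \<in> set (L x)" for x b st
    using K[of x b st] size_enc_member[OF that] by simp
qed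

lemma poly_time_rev [ptime]:
  assumes "poly_time L"
  shows "poly_time (\<lambda>x. rev (L x))"
proof -
  have *: "foldl (\<lambda>st b. b # st) st l = rev l @ st" for st l :: "'b list" by (induction l arbitrary: st) auto
  have "poly_time (\<lambda>x. foldl (\<lambda>st b. b # st) [] (L x))"
    by (rule poly_time_fold_linear[where g = "\<lambda>x b st. b # st"]) ((intro ptime assms)+, simp)
  then show ?thesis by (simp add: *)
qed

lemma poly_time_append [ptime]:
  assumes "poly_time f" "poly_time g"
  shows "poly_time (\<lambda>x. f x @ g x)"
proof -
  have *: "foldl (\<lambda>st b. b # st) st (rev l) = l @ st" for st l :: "'b list"
    by (induction l arbitrary: st) auto
  have "poly_time (\<lambda>x. foldl (\<lambda>st b. b # st) (g x) (rev (f x)))"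
    by (rule poly_time_fold_linear[where g = "\<lambda>x b st. b # st"]) ((intro ptime assms)+, simp)
  then show ?thesis by (simp add: *)
qed

lemma poly_time_filter [ptime]:
  assumes "poly_time (\<lambda>y. P (fst y) (snd y))" "poly_time L"
  shows "poly_time (\<lambda>x. filter (\<lambda>b. P x b) (L x))"
proof -
  have *: "foldl (\<lambda>st b. if Q b then b # st else st) st l = rev (filter Q l) @ st" for Q st and l :: "'b list"
    by (induction l arbitrary: st) auto
  have "poly_time (\<lambda>x. foldl (\<lambda>st b. if P x b then b # st else st) [] (L x))"
    by (rule poly_time_fold_linear[where g = "\<lambda>x b st. if P x b then b # st else st"])
      ((intro ptime poly_time_comp2[OF assms(1)] assms(2))+, simp)
  then have "poly_time (\<lambda>x. rev (foldl (\<lambda>st b. if P x b then b # st else st) [] (L x)))"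
    by (rule poly_time_rev)
  then show ?thesis by (simp add: *)
qed

lemma poly_time_Bex [ptime]:
  assumes "poly_time (\<lambda>y. P (fst y) (snd y))" "poly_time L"
  shows "poly_time (\<lambda>x. \<exists>b\<in>set (L x). P x b)"
proof -
  have "poly_time (\<lambda>x. filter (\<lambda>b. P x b) (L x) \<noteq> [])" by (intro ptime assms)
  then show ?thesis by (simp add: filter_empty_conv)
qed

lemma poly_time_Ball [ptime]:
  assumes "poly_time (\<lambda>y. P (fst y) (snd y))" "poly_time L"
  shows "poly_time (\<lambda>x. \<forall>b\<in>set (L x). P x b)"
proof -
  have "poly_time (\<lambda>x. \<not> (\<exists>b\<in>set (L x). \<not> P x b))" by (intro ptime assms)
  then show ?thesis by simp
qed

lemma poly_time_member [ptime]:
  assumes "poly_time f" "poly_time L"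
  shows "poly_time (\<lambda>x. f x \<in> set (L x))"
proof -
  have "poly_time (\<lambda>x. \<exists>b\<in>set (L x). f x = b)"
    by (intro ptime assms(2) assms(1)[THEN poly_time_comp])
  then show ?thesis by simp
qed

lemma poly_time_map [ptime]:
  assumes f: "poly_time (\<lambda>y. f (fst y) (snd y))" and L: "poly_time L"
  shows "poly_time (\<lambda>x. map (\<lambda>b. f x b) (L x))"
proof -
  have *: "foldl (\<lambda>st b. h b # st) st l = rev (map h l) @ st" for h :: "'b \<Rightarrow> 'c" and st and l :: "'b list"
    by (induction l arbitrary: st) auto
  obtain d where d: "\<And>y. size (enc (f (fst y) (snd y))) \<le> (size (enc y) + 2) ^ d"
    using poly_time_size[OF f] unfolding poly_bounded_def by blast
  have "poly_time (\<lambda>x. foldl (\<lambda>st b. f x b # st) [] (L x))"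
  proof (rule poly_time_fold_additive[where g = "\<lambda>x b st. f x b # st"])
    show "poly_bounded (\<lambda>x. Suc ((size (enc x) + size (enc (L x)) + 3) ^ d))"
      by (intro poly_bounded_intros poly_time_size L)
    fix x b and st :: "'c list"
    assume "b \<in> set (L x)"
    then have "size (enc (x, b)) + 2 \<le> size (enc x) + size (enc (L x)) + 3"
      using size_enc_member[of b "L x"] by simp
    then have "(size (enc (x, b)) + 2) ^ d \<le> (size (enc x) + size (enc (L x)) + 3) ^ d"
      by (intro power_mono) simp_all
    then show "size (enc (f x b # st)) \<le> size (enc st) + Suc ((size (enc x) + size (enc (L x)) + 3) ^ d)"
      using d[of "(x, b)"] by simp
  qed (intro ptime poly_time_comp2[OF f] L)+
  then have "poly_time (\<lambda>x. rev (foldl (\<lambda>st b. f x b # st) [] (L x)))" by (rule poly_time_rev)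
  then show ?thesis by (simp add: *)
qed

lemma poly_time_concat [ptime]:
  assumes "poly_time L"
  shows "poly_time (\<lambda>x. concat (L x))"
proof -
  have *: "foldl (\<lambda>st b. st @ b) st l = st @ concat l" for st and l :: "'b list list"
    by (induction l arbitrary: st) auto
  have "poly_time (\<lambda>x. foldl (\<lambda>st b. st @ b) [] (L x))"
    by (rule poly_time_fold_linear[where g = "\<lambda>x b st. st @ b"]) ((intro ptime assms)+, simp)
  then show ?thesis by (simp add: *)
qed

lemma poly_time_product [ptime]:
  assumes "poly_time f" "poly_time g"
  shows "poly_time (\<lambda>x. List.product (f x) (g x))"
proof -
  have *: "List.product u v = concat (map (\<lambda>a. map (\<lambda>b. (a, b)) v) u)" for u :: "'b list" and v :: "'c list"
    by (induction u) auto
  show ?thesis unfolding *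
    by (intro ptime assms[THEN poly_time_comp])
qed

lemma poly_time_take_length [ptime]:
  assumes "poly_time u" "poly_time l"
  shows "poly_time (\<lambda>x. take (length (u x)) (l x))"
proof -
  have *: "foldl (\<lambda>st b. if fst st = [] then st else (tl (fst st), b # snd st)) (v, out) w =
      (drop (length w) v, rev (take (length v) w) @ out)"
    for v :: "'b list" and out w :: "'c list"
  proof (induction w arbitrary: v out)
    case (Cons b w)
    then show ?case by (cases v) auto
  qed simp
  have "poly_time (\<lambda>x. foldl (\<lambda>st b. if fst st = [] then st else (tl (fst st), b # snd st)) (u x, []) (l x))"
  proof (rule poly_time_fold_linear[where
        g = "\<lambda>x b st. if fst st = [] then st else (tl (fst st), b # snd st)"])
    fix b :: 'c and st :: "'b list \<times> 'c list"
    show "size (enc (if fst st = [] then st else (tl (fst st), b # snd st)))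
        \<le> Suc (size (enc st) + size (enc b))"
      by (cases st; cases "fst st") auto
  qed (intro ptime assms)+
  then have "poly_time (\<lambda>x. rev (snd (foldl (\<lambda>st b. if fst st = [] then st
      else (tl (fst st), b # snd st)) (u x, []) (l x))))"
    by (intro ptime)
  then show ?thesis unfolding * by simp
qed

lemma poly_time_length_le [ptime]:
  assumes "poly_time u" "poly_time l"
  shows "poly_time (\<lambda>x. length (u x) \<le> length (l x))"
proof -
  have *: "foldl (\<lambda>st b. tl st) st w = drop (length w) st" for w :: "'c list" and st :: "'b list"
    by (induction w arbitrary: st) (auto simp: drop_Suc)
  have "poly_time (\<lambda>x. foldl (\<lambda>st b. tl st) (u x) (l x))"
  proof (rule poly_time_fold_linear[where g = "\<lambda>x b st. tl st"])
    fix b :: 'c and st :: "'b list"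
    show "size (enc (tl st)) \<le> Suc (size (enc st) + size (enc b))" by (cases st) auto
  qed (intro ptime assms)+
  then have "poly_time (\<lambda>x. foldl (\<lambda>st b. tl st) (u x) (l x) = [])" by (intro ptime)
  then show ?thesis unfolding * by simp
qed

text \<open>With equality it removes duplicates; with \<open>linked_list\<close> it picks one leader
  from each component.\<close>

definition nub :: "('a \<Rightarrow> 'a \<Rightarrow> bool) \<Rightarrow> 'a list \<Rightarrow> 'a list" where
  "nub R l = foldl (\<lambda>st b. if \<exists>a\<in>set st. R b a then st else b # st) [] l"

lemma poly_time_nub [ptime]:
  assumes "poly_time (\<lambda>y. R (fst y) (fst (snd y)) (snd (snd y)))" "poly_time L"
  shows "poly_time (\<lambda>x. nub (\<lambda>a b. R x a b) (L x))"
  unfolding nub_def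
  by (rule poly_time_fold_linear[where g = "\<lambda>x b st. if \<exists>a\<in>set st. R x b a then st else b # st"])
    ((intro ptime poly_time_comp3[OF assms(1)] assms(2))+, simp)

section \<open>The reduction\<close>

text \<open>The same tree as the number itself, so a fold over the digits can read a number.\<close>

fun bits :: "nat \<Rightarrow> bool list" where
  "bits n = (if n = 0 then [] else odd n # bits (n div 2))"

declare bits.simps [simp del]

lemma enc_bits: "enc (bits n) = enc n"
proof (induction n rule: bits.induct)
  case (1 n)
  then show ?case
    by (subst bits.simps, subst enc_nat_inst, subst enc_nat.simps)
      (auto simp: enc_bool_def enc_nat_inst)
qed

lemma poly_time_bits [ptime]: "poly_time f \<Longrightarrow> poly_time (\<lambda>x. bits (f x))"
  by (erule poly_time_recode) (rule enc_bits)

text \<open>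
  Lengths of lists serve as unary numbers. Since \<open>k\<close> is given in binary, its unary form is cut
  off at the length of \<open>vs\<close>, which keeps the state of the fold polynomial.
\<close>

definition unary :: "'a list \<Rightarrow> nat \<Rightarrow> bool list" where
  "unary vs k = snd (foldl (\<lambda>st b. (take (length vs) (fst st @ fst st),
     if b then take (length vs) (snd st @ fst st) else snd st)) (take (length vs) [True], []) (bits k))"

text \<open>The signature as a list of membership bits, so that programs can compare
  signatures.\<close>

definition code :: "'a list list \<Rightarrow> 'a \<Rightarrow> bool list" where
  "code T v = map (\<lambda>e. v \<in> set e) T"

definition codes :: "'a list \<Rightarrow> 'a list list \<Rightarrow> bool list list" where
  "codes vs T = nub (\<lambda>a b. a = b) (map (\<lambda>v. code T v) vs)"

text \<open>The two dummy codes turn the comparison into: the edges create at least three new classes.\<close>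

definition step :: "'a list \<Rightarrow> 'a list list \<Rightarrow> 'a list list \<Rightarrow> 'a list list" where
  "step vs es T = foldl (\<lambda>S p. fst p # snd p # S) T (take (length [True])
     (filter (\<lambda>p. \<not> length (codes vs (fst p # snd p # T)) \<le> length ([] # [] # codes vs T))
       (List.product es es)))"

text \<open>The list \<open>vs\<close> serves as a counter of rounds: a round that changes T adds at
  least three classes, so no more than |vs| rounds can do so.\<close>

definition greedy :: "'a list \<Rightarrow> 'a list list \<Rightarrow> 'a list list" where
  "greedy vs es = foldl (\<lambda>T v. step vs es T) [] vs"

definition outside :: "'a list \<Rightarrow> 'a list list \<Rightarrow> 'a list" where
  "outside vs T = filter (\<lambda>v. \<forall>e\<in>set T. v \<notin> set e) vs"

definition inside :: "'a list \<Rightarrow> 'a list list \<Rightarrow> 'a list" where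
  "inside vs T = filter (\<lambda>v. \<exists>e\<in>set T. v \<in> set e) vs"

definition linked_list :: "'a list list \<Rightarrow> 'a \<Rightarrow> 'a \<Rightarrow> bool" where
  "linked_list es v w \<longleftrightarrow> (\<exists>f\<in>set es. v \<in> set f \<and> w \<in> set f)"

definition serves_list :: "'a list list \<Rightarrow> 'a list \<Rightarrow> 'a list \<Rightarrow> 'a list \<Rightarrow> 'a \<Rightarrow> bool" where
  "serves_list es cs A B v \<longleftrightarrow> (\<exists>e\<in>set es.
     (\<exists>a\<in>set A. a \<in> set e) \<noteq> (\<exists>b\<in>set B. b \<in> set e) \<and>
     (\<exists>w\<in>set e. w \<in> set cs \<and> linked_list es v w))"

definition leaders :: "'a list list \<Rightarrow> 'a list \<Rightarrow> 'a list" where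
  "leaders es cs = nub (\<lambda>v w. linked_list es v w) cs"

text \<open>All pairs of points are tried, not only pairs of classes. Equivalent pairs filter the
  same leaders in the same order and hence select the same ones, so the union stays small.\<close>

definition marked :: "'a list list \<Rightarrow> 'a list \<Rightarrow> 'a list \<Rightarrow> bool list \<Rightarrow> 'a list" where
  "marked es cs xs u = concat (map (\<lambda>p. take (length u)
       (filter (\<lambda>v. serves_list es cs (fst p) (snd p) v) (leaders es cs)))
     (List.product ([] # map (\<lambda>x. [x]) xs) ([] # map (\<lambda>x. [x]) xs)))"

definition kept_list :: "'a list \<Rightarrow> 'a list list \<Rightarrow> 'a list list \<Rightarrow> bool list \<Rightarrow> 'a list" where
  "kept_list vs es T u = filter (\<lambda>w. \<exists>m\<in>set (marked es (outside vs T) (inside vs T) u).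
     linked_list es m w) (outside vs T)"

text \<open>\<open>take (length [True])\<close> selects at most one dropped vertex, in the unary
  form of \<open>take\<close> for which a program is available.\<close>

definition kernel_list ::
  "'a list \<Rightarrow> 'a list list \<Rightarrow> 'a list list \<Rightarrow> bool list \<Rightarrow> 'a list \<times> 'a list list" where
  "kernel_list vs es T u =
     (inside vs T @ kept_list vs es T u @
        take (length [True]) (filter (\<lambda>v. v \<notin> set (kept_list vs es T u)) (outside vs T)),
      filter (\<lambda>e. \<forall>w\<in>set e. w \<in> set (outside vs T) \<longrightarrow> w \<in> set (kept_list vs es T u)) es)"

text \<open>The case \<open>k = 0\<close> needs the empty instance because both size bounds are 0.
  The second test holds iff |V| \<le> k; once it fails, the cut-off in \<open>unary\<close> has had
  no effect and \<open>u\<close> has length k, so the last argument of \<open>kernel_list\<close>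
  has length 4k.\<close>

definition reduce :: "nat \<Rightarrow> 'a list \<times> 'a list list \<times> nat \<Rightarrow> 'a list \<times> 'a list list \<times> nat" where
  "reduce r = (\<lambda>(vs, es, k).
     let u = unary vs k; T = greedy vs es in
     if k = 0 then ([], [], 0)
     else if length vs \<le> length u then (vs, es, k)
     else if length (map (\<lambda>e. True) T @ u) \<le> length (codes vs T) then ([], [], 0)
     else if drop (2 * r) (outside vs T) = [] then (vs, es, k)
     else let (vs', es') = kernel_list vs es T (u @ u @ u @ u) in (vs', es', k))"

section \<open>Running time of the reduction\<close>

lemma poly_time_unary [ptime]:
  fixes f :: "'a::encodable \<Rightarrow> 'b::encodable list"
  assumes "poly_time f" "poly_time k"
  shows "poly_time (\<lambda>x. unary (f x) (k x))"
  unfolding unary_def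
proof (rule poly_time_snd, rule poly_time_fold)
  let ?g = "\<lambda>x b st. (take (length (f x)) (fst st @ fst st),
     if b then take (length (f x)) (snd st @ fst st) else snd st)"
  show "poly_time (\<lambda>y. ?g (fst y) (fst (snd y)) (snd (snd y)))"
    by (intro ptime assms[THEN poly_time_comp])
  \<comment> \<open>A round may double the state, so an explicit bound is needed; it comes from the
    truncation at the length of \<open>f x\<close>.\<close>
  show "poly_bounded (\<lambda>x. Suc (4 * size (enc (f x))))"
    by (intro poly_bounded_intros poly_time_size assms)
  fix x p q
  have len: "size (enc l) \<le> 2 * length l" for l :: "bool list"
    by (induction l) (auto simp: enc_bool_def tree_of_bool_def)
  define st where "st = foldl (\<lambda>st b. ?g x b st) (take (length (f x)) [True], []) p"
  have "length (fst st) \<le> length (f x) \<and> length (snd st) \<le> length (f x)"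
    unfolding st_def by (induction p rule: rev_induct) auto
  then have "size (enc st) \<le> Suc (4 * length (f x))"
    using len[of "fst st"] len[of "snd st"] by (simp add: enc_prod_inst)
  also have "\<dots> \<le> Suc (4 * size (enc (f x)))" using length_le_size_enc[of "f x"] by simp
  finally show "size (enc (foldl (\<lambda>st b. ?g x b st) (take (length (f x)) [True], []) p)) \<le>
      Suc (4 * size (enc (f x)))" unfolding st_def .
qed (intro ptime assms)+

lemma poly_time_codes [ptime]:
  assumes "poly_time f" "poly_time T"
  shows "poly_time (\<lambda>x. codes (f x) (T x))"
  unfolding codes_def code_def by (intro ptime assms[THEN poly_time_comp])

lemma poly_time_step [ptime]:
  assumes "poly_time f" "poly_time es" "poly_time T"
  shows "poly_time (\<lambda>x. step (f x) (es x) (T x))"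
  unfolding step_def
proof (rule poly_time_fold_linear[where g = "\<lambda>x p S. fst p # snd p # S"])
  fix p :: "'b list \<times> 'b list" and S
  show "size (enc (fst p # snd p # S)) \<le> Suc (size (enc S) + size (enc p))"
    by (simp add: enc_prod_inst)
qed (intro ptime assms[THEN poly_time_comp])+

lemma step_size: "size (enc (step vs es T)) \<le> size (enc T) + 2 * Suc (size (enc es))"
proof -
  let ?l = "filter (\<lambda>p. \<not> length (codes vs (fst p # snd p # T)) \<le> length ([] # [] # codes vs T))
       (List.product es es)"
  show ?thesis
  proof (cases ?l)
    case Nil
    then show ?thesis unfolding step_def by simp
  next
    case (Cons p l)
    then have "p \<in> set ?l" by simp
    then have "fst p \<in> set es" "snd p \<in> set es" by auto
    then show ?thesis
      unfolding step_def Cons using size_enc_member[of "fst p" es] size_enc_member[of "snd p" es] by simp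
  qed
qed

lemma poly_time_greedy [ptime]:
  assumes "poly_time f" "poly_time es"
  shows "poly_time (\<lambda>x. greedy (f x) (es x))"
  unfolding greedy_def
proof (rule poly_time_fold_additive[where g = "\<lambda>x v T. step (f x) (es x) T"])
  show "poly_bounded (\<lambda>x. 2 * Suc (size (enc (es x))))"
    by (intro poly_bounded_intros poly_time_size assms)
qed (intro ptime assms[THEN poly_time_comp] step_size)+

lemma poly_time_outside [ptime]:
  assumes "poly_time f" "poly_time T"
  shows "poly_time (\<lambda>x. outside (f x) (T x))"
  unfolding outside_def by (intro ptime assms[THEN poly_time_comp])

lemma poly_time_inside [ptime]:
  assumes "poly_time f" "poly_time T"
  shows "poly_time (\<lambda>x. inside (f x) (T x))"
  unfolding inside_def by (intro ptime assms[THEN poly_time_comp])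

lemma poly_time_linked_list [ptime]:
  assumes "poly_time es" "poly_time f" "poly_time g"
  shows "poly_time (\<lambda>x. linked_list (es x) (f x) (g x))"
  unfolding linked_list_def by (intro ptime assms[THEN poly_time_comp])

lemma poly_time_serves_list [ptime]:
  assumes "poly_time es" "poly_time cs" "poly_time A" "poly_time B" "poly_time f"
  shows "poly_time (\<lambda>x. serves_list (es x) (cs x) (A x) (B x) (f x))"
  unfolding serves_list_def by (intro ptime assms[THEN poly_time_comp])

lemma poly_time_leaders [ptime]:
  assumes "poly_time es" "poly_time cs"
  shows "poly_time (\<lambda>x. leaders (es x) (cs x))"
  unfolding leaders_def by (intro ptime assms[THEN poly_time_comp])

lemma poly_time_marked [ptime]:
  assumes "poly_time es" "poly_time cs" "poly_time xs" "poly_time u"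
  shows "poly_time (\<lambda>x. marked (es x) (cs x) (xs x) (u x))"
  unfolding marked_def by (intro ptime assms[THEN poly_time_comp])

lemma poly_time_kept_list [ptime]:
  assumes "poly_time f" "poly_time es" "poly_time T" "poly_time u"
  shows "poly_time (\<lambda>x. kept_list (f x) (es x) (T x) (u x))"
  unfolding kept_list_def by (intro ptime assms[THEN poly_time_comp])

lemma poly_time_kernel_list [ptime]:
  assumes "poly_time f" "poly_time es" "poly_time T" "poly_time u"
  shows "poly_time (\<lambda>x. kernel_list (f x) (es x) (T x) (u x))"
  unfolding kernel_list_def by (intro ptime assms[THEN poly_time_comp])

lemma poly_time_reduce: "poly_time (reduce r :: 'a::encodable list \<times> 'a list list \<times> nat \<Rightarrow> _)"
  unfolding reduce_def Let_def case_prod_beta by (intro ptime poly_time_drop)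

section \<open>Correctness of the reduction\<close>

lemma nub_snoc: "nub R (l @ [b]) = (if \<exists>a\<in>set (nub R l). R b a then nub R l else b # nub R l)"
  by (simp add: nub_def)

lemma nub_Nil [simp]: "nub R [] = []"
  by (simp add: nub_def)

lemma set_nub_subset: "set (nub R l) \<subseteq> set l"
  by (induction l rule: rev_induct) (auto simp: nub_snoc)

lemma distinct_nub: "distinct l \<Longrightarrow> distinct (nub R l)"
  using set_nub_subset[of R] by (induction l rule: rev_induct) (auto simp: nub_snoc)

lemma nub_cover: "v \<in> set l \<Longrightarrow> v \<in> set (nub R l) \<or> (\<exists>a\<in>set (nub R l). R v a)"
  by (induction l rule: rev_induct) (auto simp: nub_snoc)

lemma nub_unrelated:
  assumes "\<And>a b. R a b \<Longrightarrow> R b a"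
  shows "a \<in> set (nub R l) \<Longrightarrow> b \<in> set (nub R l) \<Longrightarrow> a \<noteq> b \<Longrightarrow> \<not> R a b"
  by (induction l rule: rev_induct) (auto simp: nub_snoc dest: assms split: if_splits)

lemma length_nub_eq: "length (nub (\<lambda>a b. a = b) l) = card (set l)"
proof -
  have "distinct (nub (\<lambda>a b. a = b) l) \<and> set (nub (\<lambda>a b. a = b) l) = set l"
    by (induction l rule: rev_induct) (auto simp: nub_snoc)
  then show ?thesis by (metis distinct_card)
qed

lemma card_image_kernel_eq:
  assumes "\<And>x y. f x = f y \<longleftrightarrow> g x = g y"
  shows "card (f ` V) = card (g ` V)"
proof (rule bij_betw_same_card)
  let ?h = "\<lambda>s. g (inv_into V f s)"
  have "g (inv_into V f (f x)) = g x" if "x \<in> V" for x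
    using f_inv_into_f[of "f x" f V] that assms by blast
  then show "bij_betw ?h (f ` V) (g ` V)"
    by (intro bij_betwI'[of "f ` V" ?h "g ` V"]) (auto simp: assms)
qed

abbreviation family :: "'a list list \<Rightarrow> 'a set set" where
  "family T \<equiv> set ` set T"

lemma length_codes: "length (codes vs T) = classes (set vs) (family T)"
proof -
  have "code T v = code T w \<longleftrightarrow> sig (family T) v = sig (family T) w" for v w
    unfolding code_def sig_def by auto
  then show ?thesis
    unfolding codes_def classes_def length_nub_eq set_map by (rule card_image_kernel_eq)
qed

definition no_growth :: "'a list \<Rightarrow> 'a list list \<Rightarrow> 'a list list \<Rightarrow> bool" where
  "no_growth vs es T \<longleftrightarrow> (\<forall>e\<in>set es. \<forall>f\<in>set es.
     length (codes vs (e # f # T)) \<le> length (codes vs T) + 2)"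

lemma step_no_growth: "no_growth vs es T \<Longrightarrow> step vs es T = T"
  unfolding no_growth_def step_def by (auto simp: filter_empty_conv)

lemma step_growth:
  assumes "\<not> no_growth vs es T"
  obtains e f where "e \<in> set es" "f \<in> set es" "step vs es T = e # f # T"
    "length (codes vs T) + 3 \<le> length (codes vs (e # f # T))"
proof -
  let ?l = "filter (\<lambda>p. \<not> length (codes vs (fst p # snd p # T)) \<le> length ([] # [] # codes vs T))
       (List.product es es)"
  have "?l \<noteq> []" using assms unfolding no_growth_def by (auto simp: filter_empty_conv)
  then obtain p l where p: "?l = p # l" by (cases ?l) auto
  then have "p \<in> set ?l" by simp
  then have "fst p \<in> set es" "snd p \<in> set es"
    "length (codes vs T) + 3 \<le> length (codes vs (fst p # snd p # T))" by auto
  moreover have "step vs es T = fst p # snd p # T" unfolding step_def p by simp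
  ultimately show thesis using that by blast
qed

text \<open>A growing step adds two edges and at least three codes, starting from no edge and one
  code. The last disjunct counts rounds: as long as T grows there are more codes than rounds, which
  must fail after |vs| rounds.\<close>

lemma greedy_invariant:
  assumes "vs \<noteq> []" and T: "T = foldl (\<lambda>T v. step vs es T) [] l"
  shows "set T \<subseteq> set es \<and> 2 + 3 * length T \<le> 2 * length (codes vs T) \<and>
    (no_growth vs es T \<or> length l < length (codes vs T))"
  using T
proof (induction l arbitrary: T rule: rev_induct)
  case Nil
  have "classes (set vs) {} = 1" using assms(1) by (simp add: classes_def sig_def image_constant_conv)
  then show ?case using Nil by (simp add: length_codes)
next
  case (snoc v l)
  define S where "S = foldl (\<lambda>T v. step vs es T) [] l"
  have T: "T = step vs es S" using snoc.prems by (simp add: S_def)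
  note IH = snoc.IH[OF S_def]
  show ?case
  proof (cases "no_growth vs es S")
    case True
    then show ?thesis using IH T step_no_growth by metis
  next
    case False
    then obtain e f where "e \<in> set es" "f \<in> set es" "step vs es S = e # f # S"
      "length (codes vs S) + 3 \<le> length (codes vs (e # f # S))" by (rule step_growth)
    then show ?thesis using IH T False by auto
  qed
qed

lemma greedy_props:
  assumes "vs \<noteq> []" "distinct vs"
  shows "set (greedy vs es) \<subseteq> set es"
    and "2 + 3 * length (greedy vs es) \<le> 2 * length (codes vs (greedy vs es))"
    and "no_growth vs es (greedy vs es)"
proof -
  have "length (codes vs (greedy vs es)) \<le> length vs"
    using classes_le_card[of "set vs"] distinct_card[OF assms(2)] by (simp add: length_codes)
  then show "set (greedy vs es) \<subseteq> set es"
    "2 + 3 * length (greedy vs es) \<le> 2 * length (codes vs (greedy vs es))"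
    "no_growth vs es (greedy vs es)"
    using greedy_invariant[OF assms(1), of "greedy vs es" es vs, OF greedy_def] by auto
qed

lemma length_unary: "length (unary vs k) = min (length vs) k"
proof -
  \<comment> \<open>\<open>p\<close> stands for the weight \<open>q\<close> of the current digit and
    \<open>a\<close> for the digits already read, both up to truncation. Truncated doubling and
    addition agree with the exact ones under \<open>min\<close>, so cutting early does no
    harm.\<close>
  have "min (length vs) (length p) = min (length vs) q \<Longrightarrow> length p \<le> length vs \<Longrightarrow>
      length a \<le> length vs \<Longrightarrow>
    length (snd (foldl (\<lambda>st b. (take (length vs) (fst st @ fst st),
      if b then take (length vs) (snd st @ fst st) else snd st)) (p, a) (bits k))) =
    min (length vs) (length a + q * k)" for p a :: "bool list" and q
  proof (induction k arbitrary: p a q rule: bits.induct)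
    case (1 k)
    show ?case
    proof (cases "k = 0")
      case True
      then show ?thesis using 1(4) by (simp add: bits.simps[of 0])
    next
      case False
      let ?p = "take (length vs) (p @ p)"
      let ?a = "if odd k then take (length vs) (a @ p) else a"
      have mn: "min (length vs) (length ?p) = min (length vs) (2 * q)"
        using 1(2) by (auto simp: min_def split: if_splits)
      have len: "length ?p \<le> length vs" "length ?a \<le> length vs" using 1(4) by (auto simp: min_def)
      have bits: "bits k = odd k # bits (k div 2)" using False by (subst bits.simps) simp
      have "length (snd (foldl (\<lambda>st b. (take (length vs) (fst st @ fst st),
          if b then take (length vs) (snd st @ fst st) else snd st)) (?p, ?a) (bits (k div 2)))) =
        min (length vs) (length ?a + 2 * q * (k div 2))" by (rule 1(1)[OF False mn len])
      also have "\<dots> = min (length vs) (length a + q * k)"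
      proof (cases "odd k")
        case True
        then obtain j where "k = 2 * j + 1" by (rule oddE)
        then show ?thesis using 1(2) by (auto simp: min_def algebra_simps split: if_splits)
      next
        case False
        then obtain j where "k = 2 * j" by (auto elim: evenE)
        then show ?thesis by (simp add: algebra_simps)
      qed
      finally show ?thesis unfolding bits foldl.simps fst_conv snd_conv .
    qed
  qed
  from this[of "take (length vs) [True]" 1 "[]"] show ?thesis
    unfolding unary_def by simp
qed

text \<open>Padding with its own head makes every nonempty edge the set of a list of length exactly
  r. The strict inequality \<open>card V < N\<close> makes room for the empty edge, which is why the
  vertex bounds below are strict.\<close>

lemma card_bounded_edges:
  assumes "finite V" "E \<subseteq> Pow V" "\<forall>e\<in>E. card e \<le> r" "card V < N" "1 \<le> r"
  shows "card E \<le> N ^ r"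
proof -
  let ?L = "{xs. set xs \<subseteq> V \<and> length xs = r}"
  have "E \<subseteq> insert {} (set ` ?L)"
  proof
    fix e assume e: "e \<in> E"
    then have fin: "finite e" and eV: "e \<subseteq> V" using assms finite_subset by blast+
    show "e \<in> insert {} (set ` ?L)"
    proof (cases "e = {}")
      case False
      obtain ys where ys: "set ys = e" "distinct ys" using finite_distinct_list[OF fin] by blast
      define xs where "xs = ys @ replicate (r - length ys) (hd ys)"
      have "length ys \<le> r" using ys assms(3) e distinct_card by metis
      moreover have "ys \<noteq> []" using ys False by auto
      ultimately have "length xs = r" "set xs = e"
        using ys hd_in_set[of ys] unfolding xs_def by (auto simp: set_replicate_conv_if)
      then show ?thesis using eV by blast
    qed simp
  qed
  moreover have finL: "finite ?L" using finite_lists_length_eq[OF assms(1)] .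
  ultimately have "card E \<le> card (insert {} (set ` ?L))" by (intro card_mono) auto
  also have "\<dots> \<le> Suc (card (set ` ?L))" using finL by (simp add: card_insert_if)
  also have "\<dots> \<le> Suc (card V ^ r)"
    using card_image_le[OF finL, of set] card_lists_length_eq[OF assms(1), of r] by simp
  also have "\<dots> \<le> N ^ r"
    using power_strict_mono[OF assms(4), of r] assms(5) by simp
  finally show ?thesis .
qed

text \<open>Since N depends only on the values of \<open>s\<close>, is symmetric and vanishes on the
  diagonal, the union runs over two-element sets of values. This gives a binomial coefficient where
  a square would exceed the required constant.\<close>

lemma card_symmetric_UN:
  fixes N :: "'p \<Rightarrow> 'p \<Rightarrow> 'a set" and s :: "'p \<Rightarrow> 'q"
  assumes fin: "finite P"
    and cong: "\<And>A A' B B'. A \<in> P \<Longrightarrow> A' \<in> P \<Longrightarrow> B \<in> P \<Longrightarrow> B' \<in> P \<Longrightarrow>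
        s A = s A' \<Longrightarrow> s B = s B' \<Longrightarrow> N A B = N A' B'"
    and sym: "\<And>A B. N A B = N B A" and refl: "\<And>A. N A A = {}"
    and le: "\<And>A B. finite (N A B) \<and> card (N A B) \<le> L"
  shows "card (\<Union>A\<in>P. \<Union>B\<in>P. N A B) \<le> (card (s ` P) choose 2) * L"
proof -
  define rep where "rep = inv_into P s"
  have rep: "rep (s A) \<in> P" "s (rep (s A)) = s A" if "A \<in> P" for A
    unfolding rep_def using that by (auto intro: inv_into_into f_inv_into_f)
  define H where "H K = (\<Union>a\<in>K. \<Union>b\<in>K. N (rep a) (rep b))" for K
  let ?KK = "{K. K \<subseteq> s ` P \<and> card K = 2}"
  have finKK: "finite ?KK" using fin by simp
  have H: "finite (H K) \<and> card (H K) \<le> L" if K: "K \<in> ?KK" for K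
  proof -
    obtain a b where "K = {a, b}" using K card_2_iff[of K] by blast
    then have "H K = N (rep a) (rep b)" unfolding H_def using refl sym[of "rep b" "rep a"] by auto
    then show ?thesis using le by simp
  qed
  have "(\<Union>A\<in>P. \<Union>B\<in>P. N A B) \<subseteq> (\<Union>K\<in>?KK. H K)"
  proof
    fix x assume "x \<in> (\<Union>A\<in>P. \<Union>B\<in>P. N A B)"
    then obtain A B where AB: "A \<in> P" "B \<in> P" "x \<in> N A B" by blast
    have "s A \<noteq> s B" using cong[of A A B A] AB refl by auto
    moreover have "x \<in> N (rep (s A)) (rep (s B))"
      using cong[of A "rep (s A)" B "rep (s B)"] AB rep by auto
    ultimately show "x \<in> (\<Union>K\<in>?KK. H K)"
      using AB unfolding H_def by (intro UN_I[of "{s A, s B}"]) auto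
  qed
  then have "card (\<Union>A\<in>P. \<Union>B\<in>P. N A B) \<le> card (\<Union>K\<in>?KK. H K)"
    using finKK H by (intro card_mono) auto
  also have "\<dots> \<le> (\<Sum>K\<in>?KK. card (H K))" by (rule card_UN_le[OF finKK])
  also have "\<dots> \<le> (\<Sum>K\<in>?KK. L)" using H by (intro sum_mono) blast
  also have "\<dots> = (card (s ` P) choose 2) * L" using n_subsets[of "s ` P" 2] fin by simp
  finally show ?thesis .
qed

section \<open>The list functions and the sets they represent\<close>

lemma linked_list_iff: "linked_list es = linked (family es)"
  unfolding linked_list_def linked_def by (intro ext) auto

lemma serves_list_iff:
  "serves_list es cs A B v \<longleftrightarrow> serves (family es) (set cs) (set A) (set B) v"
  unfolding serves_list_def serves_def splits_def linked_list_iff by (simp add: disjoint_iff) blast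

lemma set_outside: "set (outside vs T) = set vs - \<Union>(family T)"
  unfolding outside_def by auto

lemma set_inside: "set (inside vs T) = set vs \<inter> \<Union>(family T)"
  unfolding inside_def by auto

lemma points_list: "set ` set ([] # map (\<lambda>x. [x]) xs) = points (set xs)"
  unfolding points_def by (simp add: image_image)

definition chosen :: "'a list list \<Rightarrow> 'a list \<Rightarrow> nat \<Rightarrow> 'a set \<Rightarrow> 'a set \<Rightarrow> 'a set" where
  "chosen es cs l A B = set (take l (filter (serves (family es) (set cs) A B) (leaders es cs)))"

lemma set_marked:
  "set (marked es cs xs u) = (\<Union>A\<in>points (set xs). \<Union>B\<in>points (set xs). chosen es cs (length u) A B)"
  unfolding marked_def chosen_def points_list[symmetric] serves_list_iff by auto

lemma card_chosen: "finite (chosen es cs l A B) \<and> card (chosen es cs l A B) \<le> l"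
  unfolding chosen_def by (metis List.finite_set card_length length_take min.cobounded2 order_trans)

lemma splits_sym: "splits A B e \<longleftrightarrow> splits B A e"
  unfolding splits_def by blast

lemma serves_sym: "serves E C A B = serves E C B A"
  unfolding serves_def using splits_sym by blast

lemma serves_refl: "\<not> serves E C A A v"
  unfolding serves_def splits_def by blast

text \<open>What holds after the greedy phase if T does not already prove the instance to be a
  yes-instance.\<close>

locale instance_lists =
  fixes r k :: nat and vs :: "'a list" and es T :: "'a list list"
  assumes r2: "2 \<le> r" and dvs: "distinct vs"
    and EV: "family es \<subseteq> Pow (set vs)" and card_edge: "e \<in> family es \<Longrightarrow> card e \<le> r"
    and tc: "test_cover (set vs) (family es)"
    and T: "set T \<subseteq> set es" and T_len: "2 + 3 * length T \<le> 2 * length (codes vs T)"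
    and T_stuck: "no_growth vs es T"
    and few: "length (codes vs T) < length T + k"
begin

abbreviation "V \<equiv> set vs"
abbreviation "E \<equiv> family es"

text \<open>\<open>T_len\<close> records that two edges pay for three classes; together with
  \<open>few\<close> it bounds |T|, and |T| bounds the classes.\<close>

lemma k2: "2 \<le> k" and T_le: "length T + 4 \<le> 2 * k" and codes_le: "length (codes vs T) + 5 \<le> 3 * k"
  using T_len few by linarith+

lemma card_X: "card (\<Union>(family T)) \<le> length T * r"
proof -
  have "card (\<Union>(family T)) \<le> (\<Sum>e\<in>set T. card (set e))"
    using card_UN_le[of "set T" set] by simp
  also have "\<dots> \<le> (\<Sum>e\<in>set T. r)"
    using card_edge T by (intro sum_mono) auto
  also have "\<dots> \<le> length T * r" using card_length[of T] by simp
  finally show ?thesis .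
qed

lemma small_if_outside_small:
  assumes "length (outside vs T) \<le> 2 * r"
  shows "card V < 18 * k ^ 3 * r"
proof -
  have "V \<subseteq> \<Union>(family T) \<union> set (outside vs T)" unfolding set_outside by blast
  then have "card V \<le> card (\<Union>(family T) \<union> set (outside vs T))" by (intro card_mono) auto
  also have "\<dots> \<le> card (\<Union>(family T)) + card (set (outside vs T))" by (rule card_Un_le)
  also have "\<dots> \<le> length T * r + 2 * r"
    using card_X card_length[of "outside vs T"] assms by linarith
  also have "\<dots> = (length T + 2) * r" by (simp add: algebra_simps)
  also have "\<dots> < 18 * k ^ 3 * r"
  proof -
    have "k ^ 1 \<le> k ^ 3" using k2 by (intro power_increasing) auto
    then have "k \<le> k ^ 3" by simp
    then have "length T + 2 < 18 * k ^ 3" using T_le k2 by linarith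
    then show ?thesis using r2 by (intro mult_strict_right_mono) simp_all
  qed
  finally show ?thesis .
qed

context
  fixes u :: "bool list"
  assumes big: "2 * r < length (outside vs T)" and u: "length u = 4 * k"
begin

lemma stuck: "stuck V E (family T) r"
proof
  show "1 \<le> r" using r2 by simp
  have "distinct (outside vs T)" using dvs unfolding outside_def by simp
  then show "2 * r < card (V - \<Union>(family T))"
    using big distinct_card[of "outside vs T"] by (simp add: set_outside)
  show "family T \<subseteq> E" using T by blast
  fix e f assume "e \<in> E" "f \<in> E"
  then obtain e' f' where "e' \<in> set es" "f' \<in> set es" "e = set e'" "f = set f'" by blast
  then show "classes V (insert e (insert f (family T))) \<le> classes V (family T) + 2"
    using T_stuck unfolding no_growth_def length_codes by simp
qed (use EV tc card_edge in auto)

abbreviation "cs \<equiv> outside vs T"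
abbreviation "M \<equiv> marked es cs (inside vs T) u"

lemma X_eq: "set (inside vs T) = \<Union>(family T)"
  unfolding set_inside using stuck.XV[OF stuck] by blast

lemma distinct_leaders: "distinct (leaders es cs)"
  unfolding leaders_def outside_def using dvs by (simp add: distinct_nub)

lemma kernel: "kernel V E (family T) r k (set (leaders es cs)) (set M)"
proof -
  interpret stuck V E "family T" r by (rule stuck)
  have C: "set cs = V - \<Union>(family T)" by (rule set_outside)
  have sub: "set (leaders es cs) \<subseteq> V - \<Union>(family T)"
    unfolding leaders_def C[symmetric] by (rule set_nub_subset)
  show ?thesis
  proof unfold_locales
    show "1 \<le> k" using k2 by simp
    show "set (leaders es cs) \<subseteq> V - \<Union>(family T)" by (rule sub)
    show "\<exists>l\<in>set (leaders es cs). linked E l v"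
      if "v \<in> V - \<Union>(family T)" "linked E v v" for v
    proof -
      have "v \<in> set (leaders es cs) \<or> (\<exists>a\<in>set (leaders es cs). linked E v a)"
        using nub_cover[of v cs "linked E"] that(1) unfolding leaders_def C linked_list_iff by blast
      then show ?thesis using that(2) linked_sym by blast
    qed
    show "l = l'" if "l \<in> set (leaders es cs)" "l' \<in> set (leaders es cs)" "linked E l l'" for l l'
    proof (rule ccontr)
      assume "l \<noteq> l'"
      then have "\<not> linked E l l'"
        using nub_unrelated[of "linked E" l cs l', OF linked_sym] that(1,2)
        unfolding leaders_def linked_list_iff by blast
      then show False using that(3) by blast
    qed
    show "set M \<subseteq> set (leaders es cs)"
      unfolding set_marked chosen_def using set_take_subset by fastforce
    fix A B l
    assume AB: "A \<in> points (\<Union>(family T))" "B \<in> points (\<Union>(family T))"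
      and l: "l \<in> set (leaders es cs)" "l \<notin> set M" "serves E (V - \<Union>(family T)) A B l"
    let ?f = "filter (serves E (set cs) A B) (leaders es cs)"
    have sub: "set (take (4 * k) ?f) \<subseteq> set M"
      using AB u unfolding set_marked X_eq chosen_def by auto
    have "l \<in> set ?f" using l C by simp
    \<comment> \<open>The leader \<open>l\<close> passes the filter without being selected, so the
      list was truncated and 4k others were selected.\<close>
    then have "take (4 * k) ?f \<noteq> ?f" using sub l by auto
    then have "length (take (4 * k) ?f) = 4 * k" by auto
    moreover have "distinct (take (4 * k) ?f)" using distinct_leaders by simp
    ultimately have "4 * k = card (set (take (4 * k) ?f))" using distinct_card by metis
    also have "\<dots> \<le> card {m \<in> set M. serves E (V - \<Union>(family T)) A B m}"
    proof (rule card_mono)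
      show "set (take (4 * k) ?f) \<subseteq> {m \<in> set M. serves E (V - \<Union>(family T)) A B m}"
        using sub set_take_subset[of "4 * k" ?f] C by auto
    qed simp
    finally show "4 * k \<le> card {m \<in> set M. serves E (V - \<Union>(family T)) A B m}" .
  qed
qed

lemma card_M: "card (set M) \<le> (length (codes vs T) choose 2) * (4 * k)"
proof -
  interpret stuck V E "family T" r by (rule stuck)
  let ?s = "\<lambda>A. {e \<in> family T. A \<inter> e \<noteq> {}}"
  have C: "set cs = V - \<Union>(family T)" by (rule set_outside)
  have "card (set M) \<le> (card (?s ` points (\<Union>(family T))) choose 2) * (4 * k)"
    unfolding set_marked X_eq u
  proof (rule card_symmetric_UN)
    show "finite (points (\<Union>(family T)))" unfolding points_def by simp
    show "chosen es cs (4 * k) A B = chosen es cs (4 * k) A' B'"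
      if "A \<in> points (\<Union>(family T))" "A' \<in> points (\<Union>(family T))" "B \<in> points (\<Union>(family T))"
        "B' \<in> points (\<Union>(family T))" "?s A = ?s A'" "?s B = ?s B'" for A A' B B'
      using serves_cong[OF that] unfolding chosen_def C by presburger
    show "chosen es cs (4 * k) A B = chosen es cs (4 * k) B A" for A B
      unfolding chosen_def by (subst serves_sym) simp
    show "chosen es cs (4 * k) A A = {}" for A
      unfolding chosen_def by (simp add: serves_refl)
  qed (rule card_chosen)
  also have "\<dots> \<le> (length (codes vs T) choose 2) * (4 * k)"
    using card_point_sigs by (intro mult_le_mono1 binomial_right_mono) (simp add: length_codes)
  finally show ?thesis .
qed

lemma kernel_bound: "length T * r + (length (codes vs T) choose 2) * (4 * k) * r + 1 < 18 * k ^ 3 * r"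
proof -
  let ?c = "length (codes vs T)"
  have "even (?c * (?c - 1))" by (cases ?c) auto
  then have choose: "2 * (?c choose 2) = ?c * (?c - 1)" unfolding choose_two by (rule dvd_mult_div_cancel)
  have "(?c choose 2) * (4 * k) = 2 * k * (2 * (?c choose 2))" by simp
  also note choose
  also have "2 * k * (?c * (?c - 1)) \<le> 2 * k * (3 * k * (3 * k - 1))"
    using codes_le by (intro mult_le_mono) auto
  \<comment> \<open>The 6k^2 lost by 3k(3k-1) against 9k^2 exceed |T| + 1, which accounts for X and
    the extra vertex.\<close>
  also have "\<dots> + 6 * k * k = 18 * k ^ 3"
    using k2 by (simp add: power3_eq_cube algebra_simps diff_mult_distrib2)
  finally have 1: "(?c choose 2) * (4 * k) + 6 * k * k \<le> 18 * k ^ 3" by simp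
  have "2 * k \<le> k * k" using k2 by simp
  then have "length T + (?c choose 2) * (4 * k) + 1 < 18 * k ^ 3"
    using 1 T_le k2 by linarith
  then have "(length T + (?c choose 2) * (4 * k) + 1) * r < 18 * k ^ 3 * r"
    using r2 by (intro mult_strict_right_mono) simp_all
  moreover have "length T * r + (?c choose 2) * (4 * k) * r + 1 \<le> (length T + (?c choose 2) * (4 * k) + 1) * r"
    using r2 by (simp add: algebra_simps)
  ultimately show ?thesis by linarith
qed

lemma kernel_list_correct:
  assumes "kernel_list vs es T u = (vs', es')"
  shows "distinct vs'" "set es' \<subseteq> set es" "distinct (map set es) \<Longrightarrow> distinct (map set es')"
    "set vs' \<subseteq> V" "family es' \<subseteq> Pow (set vs')" "test_cover (set vs') (family es')"
    "card (set vs') < 18 * k ^ 3 * r"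
    "(\<exists>F\<subseteq>family es'. int k \<le> excess (set vs') F) \<longleftrightarrow> (\<exists>F\<subseteq>E. int k \<le> excess V F)"
proof -
  interpret K: kernel V E "family T" r k "set (leaders es cs)" "set M" by (rule kernel)
  let ?ks = "kept_list vs es T u"
  let ?z = "take (length [True]) (filter (\<lambda>v. v \<notin> set ?ks) cs)"
  have C: "set cs = V - \<Union>(family T)" by (rule set_outside)
  have ks: "set ?ks = K.kept"
    unfolding kept_list_def K.kept_def C[symmetric] linked_list_iff by auto
  have ks_sub: "K.kept \<subseteq> set cs" unfolding C K.kept_def by blast
  have vs': "vs' = inside vs T @ ?ks @ ?z"
    and es': "es' = filter (\<lambda>e. \<forall>w\<in>set e. w \<in> set cs \<longrightarrow> w \<in> set ?ks) es"
    using assms unfolding kernel_list_def by auto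
  have dcs: "distinct cs" "distinct (inside vs T)" "distinct ?ks" "distinct ?z"
    using dvs unfolding outside_def inside_def kept_list_def by simp_all
  have zs: "set ?z \<subseteq> set cs - K.kept"
    using set_take_subset[of "length [True]" "filter (\<lambda>v. v \<notin> set ?ks) cs"] ks by auto
  have disj: "set (inside vs T) \<inter> set cs = {}" unfolding X_eq C by blast
  show "distinct vs'"
    unfolding vs' using dcs zs disj ks ks_sub by (simp, blast)
  show "set es' \<subseteq> set es" unfolding es' by auto
  show "distinct (map set es) \<Longrightarrow> distinct (map set es')"
    unfolding es' by (rule distinct_map_filter)
  show sub: "set vs' \<subseteq> V"
    unfolding vs' using zs ks ks_sub by (auto simp: set_inside C)
  have E': "family es' = K.E'"
    unfolding es' K.E'_def ks C[symmetric] by auto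
  \<comment> \<open>If no vertex is dropped, \<open>?z\<close> is empty and any value of
    \<open>z\<close> will do.\<close>
  obtain z where z: "set ?z \<subseteq> {z}" "set cs \<subseteq> K.kept \<or> z \<in> set ?z"
  proof (cases "filter (\<lambda>v. v \<notin> set ?ks) cs")
    case Nil
    then have "set cs \<subseteq> K.kept" using ks by (auto simp: filter_empty_conv)
    then show ?thesis using that Nil by simp
  next
    case (Cons z l)
    then show ?thesis using that[of z] by simp
  qed
  have in_C: "set vs' \<inter> (V - \<Union>(family T)) \<subseteq> insert z K.kept"
    unfolding vs' using z(1) ks disj C by auto
  have X_sub: "\<Union>(family T) \<subseteq> set vs'" unfolding vs' using X_eq by simp
  have kept_sub: "K.kept \<subseteq> set vs'" unfolding vs' ks[symmetric] by auto
  have z': "V - \<Union>(family T) \<subseteq> K.kept \<or> z \<in> set vs' \<inter> (V - \<Union>(family T)) - K.kept"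
  proof (cases "set cs \<subseteq> K.kept")
    case False
    then have "z \<in> set ?z" using z(2) by blast
    then have "z \<in> set vs'" "z \<in> set cs - K.kept" using zs unfolding vs' by auto
    then show ?thesis unfolding C by blast
  qed (simp add: C)
  show "family es' \<subseteq> Pow (set vs')"
    unfolding E' using X_sub kept_sub K.edge_sub unfolding K.E'_def by blast
  show "test_cover (set vs') (family es')"
    unfolding E' by (rule K.kernel_test_cover[OF sub in_C])
  show "(\<exists>F\<subseteq>family es'. int k \<le> excess (set vs') F) \<longleftrightarrow> (\<exists>F\<subseteq>E. int k \<le> excess V F)"
    unfolding E' by (rule K.kernel_excess_iff[OF sub X_sub in_C kept_sub z'])
  have "card (set ?z) \<le> 1" using card_mono[OF _ z(1)] by simp
  moreover have "card (set ?ks) \<le> (length (codes vs T) choose 2) * (4 * k) * r"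
    unfolding ks using K.card_kept card_M by (meson mult_le_mono1 order_trans)
  moreover have "card (set (inside vs T)) \<le> length T * r" unfolding X_eq by (rule card_X)
  moreover have "card (set vs') \<le> card (set (inside vs T)) + (card (set ?ks) + card (set ?z))"
    unfolding vs' set_append by (meson add_left_mono card_Un_le order_trans)
  ultimately show "card (set vs') < 18 * k ^ 3 * r" using kernel_bound by linarith
qed

end

end

section \<open>From lists to encoded instances\<close>

definition encodes_lists :: "nat list \<Rightarrow> nat list list \<Rightarrow> bool" where
  "encodes_lists vs es \<longleftrightarrow> distinct vs \<and> (\<forall>e\<in>set es. distinct e) \<and> distinct (map set es)"

lemma encodes_iff:
  "encodes x (V, E, k) \<longleftrightarrow>
    (\<exists>vs es. encodes_lists vs es \<and> set vs = V \<and> family es = E \<and> x = enc (vs, es, k))"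
  unfolding encodes_def encodes_lists_def enc_Pair enc_list_inst enc_nat_inst by (auto simp: image_image)

lemma equivalent_if_excess_iff:
  assumes "test_r_cover_instance r (V, E, k)" "test_r_cover_instance r (V', E', k)"
    "(\<exists>F\<subseteq>E'. int k \<le> excess V' F) \<longleftrightarrow> (\<exists>F\<subseteq>E. int k \<le> excess V F)"
  shows "equivalent_instances (V, E, k) (V', E', k)"
  using assms yes_instance_iff_excess[of V E k] yes_instance_iff_excess[of V' E' k]
  unfolding equivalent_instances_def test_r_cover_instance_def by auto

lemma reduce_correct:
  assumes r: "2 \<le> r" and wf: "encodes_lists vs es"
    and inst: "test_r_cover_instance r (set vs, family es, k)"
    and red: "reduce r (vs, es, k) = (vs', es', k')"
  shows "encodes_lists vs' es' \<and> test_r_cover_instance r (set vs', family es', k') \<and>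
    equivalent_instances (set vs, family es, k) (set vs', family es', k') \<and>
    card (set vs') \<le> 18 * k ^ 3 * r \<and> card (family es') \<le> (18 * k ^ 3 * r) ^ r"
proof -
  let ?V = "set vs" and ?E = "family es"
  let ?T = "greedy vs es" and ?u = "unary vs k"
  have EV: "?E \<subseteq> Pow ?V" and card_edge: "\<forall>e\<in>?E. card e \<le> r" and tc: "test_cover ?V ?E"
    using inst unfolding test_r_cover_instance_def by auto
  have yes: "yes_instance (?V, ?E, k) \<longleftrightarrow> (\<exists>F\<subseteq>?E. int k \<le> excess ?V F)"
    by (rule yes_instance_iff_excess[OF finite_set EV tc])
  have trivial_yes: ?thesis
    if y: "yes_instance (?V, ?E, k)" and e: "vs' = []" "es' = []" "k' = 0"
  proof -
    have "yes_instance ({}, {}, 0)" unfolding yes_instance_def by (simp add: test_cover_def)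
    then show ?thesis
      using y e unfolding equivalent_instances_def encodes_lists_def test_r_cover_instance_def
      by (simp add: test_cover_def)
  qed
  have unchanged: ?thesis
    if "card ?V < 18 * k ^ 3 * r" and e: "vs' = vs" "es' = es" "k' = k"
  proof -
    have "card ?E \<le> (18 * k ^ 3 * r) ^ r"
      by (rule card_bounded_edges[OF finite_set EV card_edge that(1)]) (use r in simp)
    then show ?thesis using that(1) wf inst unfolding e equivalent_instances_def by simp
  qed
  note red = red[unfolded reduce_def Let_def prod.case]
  consider "k = 0" | "0 < k" "length vs \<le> k" | "0 < k" "k < length vs" by linarith
  then show ?thesis
  proof cases
    case 1
    have "0 \<le> excess ?V {}" unfolding excess_def by simp
    then have "yes_instance (?V, ?E, k)" unfolding yes using 1 by auto
    then show ?thesis using trivial_yes red 1 by simp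
  next
    case 2
    have "k * 1 \<le> k ^ 3 * r"
      using r 2 power_increasing[of 1 3 k] by (intro mult_le_mono) auto
    then have "card ?V < 18 * k ^ 3 * r" using card_length[of vs] 2 by linarith
    then show ?thesis using unchanged red 2 by (simp add: length_unary)
  next
    case 3
    have u: "length ?u = k" using 3 by (simp add: length_unary)
    have ne: "vs \<noteq> []" using 3 by auto
    have dvs: "distinct vs" using wf unfolding encodes_lists_def by blast
    note T = greedy_props[OF ne dvs, of es]
    show ?thesis
    proof (cases "length ?T + k \<le> length (codes vs ?T)")
      case True
      have "card (family ?T) \<le> length ?T"
        using card_image_le[of "set ?T" set] card_length[of ?T] by simp
      then have "int k \<le> excess ?V (family ?T)"
        using True unfolding excess_def length_codes by linarith
      moreover have "family ?T \<subseteq> ?E" using T(1) by (rule image_mono)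
      ultimately have "yes_instance (?V, ?E, k)" unfolding yes by (intro exI conjI)
      then show ?thesis using trivial_yes red 3 True u by simp
    next
      case False
      interpret L: instance_lists r k vs es ?T
        by unfold_locales (use r dvs EV card_edge tc T False in auto)
      show ?thesis
      proof (cases "length (outside vs ?T) \<le> 2 * r")
        case True
        then show ?thesis
          using unchanged[OF L.small_if_outside_small[OF True]] red 3 False u by simp
      next
        case big: False
        have kl: "kernel_list vs es ?T (?u @ ?u @ ?u @ ?u) = (vs', es')" and k': "k' = k"
          using red 3 False u big by (auto split: prod.splits)
        note K = L.kernel_list_correct[OF _ _ kl]
        have b: "2 * r < length (outside vs ?T)" "length (?u @ ?u @ ?u @ ?u) = 4 * k"
          using big u by simp_all
        note K = K[OF b]
        have "\<forall>e\<in>family es'. card e \<le> r" using card_edge K(2) by (metis image_mono subsetD)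
        then have inst': "test_r_cover_instance r (set vs', family es', k')"
          unfolding test_r_cover_instance_def using K(5,6) by simp
        moreover have "encodes_lists vs' es'"
          using wf K(1,3) subsetD[OF K(2)] unfolding encodes_lists_def by simp
        moreover have "equivalent_instances (?V, ?E, k) (set vs', family es', k')"
          using equivalent_if_excess_iff[OF inst inst'[unfolded k'] K(8)] unfolding k' .
        moreover have "card (family es') \<le> (18 * k ^ 3 * r) ^ r"
          by (rule card_bounded_edges[OF finite_set K(5) _ K(7)])
            (use \<open>\<forall>e\<in>family es'. card e \<le> r\<close> r in auto)
        ultimately show ?thesis using K(7) by simp
      qed
    qed
  qed
qed

lemma poly_time_on_enc:
  fixes h :: "'a::encodable \<Rightarrow> 'b::encodable"
  assumes "poly_time h" "\<And>x. x \<in> A \<Longrightarrow> \<exists>y. x = enc y \<and> f x = enc (h y)"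
  shows "poly_time_on A f"
proof -
  obtain c b where "poly_bounded b"
    and c: "\<forall>x s. s 0 = enc x \<longrightarrow> (\<exists>s'. runs c s (b x) s' \<and> s' 0 = enc (h x))"
    using assms(1) by (rule poly_timeE)
  then obtain d where d: "\<And>x. b x \<le> (size (enc x) + 2) ^ d" unfolding poly_bounded_def by blast
  \<comment> \<open>\<open>[:2, 1:] ^ d\<close> is the polynomial (n + 2)^d of
    \<open>poly_bounded\<close>.\<close>
  have "\<exists>t \<le> poly ([:2, 1:] ^ d) (size x). computes_in c x t (f x)" if x: "x \<in> A" for x
  proof -
    obtain y where y: "x = enc y" "f x = enc (h y)" using assms(2)[OF x] by blast
    have "((\<lambda>_. Leaf)(0 := x)) 0 = enc y" using y by simp
    then obtain s' where "runs c ((\<lambda>_. Leaf)(0 := x)) (b y) s'" "s' 0 = f x"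
      using c y by metis
    then obtain t where t: "t \<le> b y" "exec c ((\<lambda>_. Leaf)(0 := x)) t s'" "s' 0 = f x"
      unfolding runs_def by blast
    have "t \<le> poly ([:2, 1:] ^ d) (size x)"
      using t(1) d[of y] y by (simp add: poly_power add.commute)
    then show ?thesis using t(2,3) unfolding computes_in_def by blast
  qed
  then show ?thesis unfolding poly_time_on_def by blast
qed

theorem theorem19:
  fixes r :: nat
  assumes "r \<ge> 2"
  shows "\<exists>f. poly_time_on {x. \<exists>I. test_r_cover_instance r I \<and> encodes x I} f \<and>
    (\<forall>V E k x. test_r_cover_instance r (V, E, k) \<and> encodes x (V, E, k) \<longrightarrow>
      (\<exists>V' E' k'. encodes (f x) (V', E', k') \<and>
        test_r_cover_instance r (V', E', k') \<and>
        equivalent_instances (V, E, k) (V', E', k') \<and>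
        card V' \<le> 18 * k ^ 3 * r \<and>
        card E' \<le> (18 * k ^ 3 * r) ^ r))"
proof -
  define h :: "nat list \<times> nat list list \<times> nat \<Rightarrow> nat list \<times> nat list list \<times> nat" where "h = reduce r"
  \<comment> \<open>On trees that encode no triple the value is arbitrary;
    \<open>poly_time_on\<close> concerns only encodings of instances.\<close>
  define f where "f x = enc (h (inv enc x))" for x
  have "inj (enc :: nat list \<times> nat list list \<times> nat \<Rightarrow> tree)" by (auto intro: injI enc_inject)
  then have f: "f (enc y) = enc (h y)" for y unfolding f_def by (simp add: inv_f_f)
  show ?thesis
  proof (intro exI[of _ f] conjI allI impI)
    show "poly_time_on {x. \<exists>I. test_r_cover_instance r I \<and> encodes x I} f"
    proof (rule poly_time_on_enc[of h])
      show "poly_time h" unfolding h_def by (rule poly_time_reduce)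
      show "\<exists>y. x = enc y \<and> f x = enc (h y)"
        if x: "x \<in> {x. \<exists>I. test_r_cover_instance r I \<and> encodes x I}" for x
      proof -
        obtain V E k where "encodes x (V, E, k)" using x by auto
        then obtain vs :: "nat list" and es :: "nat list list" where "x = enc (vs, es, k)"
          unfolding encodes_iff by blast
        then show ?thesis using f by blast
      qed
    qed
  next
    fix V E k x
    assume "test_r_cover_instance r (V, E, k) \<and> encodes x (V, E, k)"
    then obtain vs es where v: "encodes_lists vs es" "set vs = V" "family es = E" "x = enc (vs, es, k)"
      and inst: "test_r_cover_instance r (V, E, k)" by (auto simp: encodes_iff)
    obtain vs' es' k' where red: "reduce r (vs, es, k) = (vs', es', k')" by (metis prod_cases3)
    then have fx: "f x = enc (vs', es', k')" by (simp only: v(4) f h_def)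
    note R = reduce_correct[OF assms v(1) _ red, unfolded v(2,3), OF inst]
    then have "encodes (f x) (set vs', family es', k')" unfolding fx encodes_iff by blast
    then show "\<exists>V' E' k'. encodes (f x) (V', E', k') \<and>
        test_r_cover_instance r (V', E', k') \<and>
        equivalent_instances (V, E, k) (V', E', k') \<and>
        card V' \<le> 18 * k ^ 3 * r \<and> card E' \<le> (18 * k ^ 3 * r) ^ r"
      using R by blast
  qed
qed

end
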